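(* The locus of Hodge structures of K3-type on $\Lambda:= U^2_{\mathbb{Q}}\oplus E_8(-2)_{\mathbb{Q}}$ which admit a Hodge similarity of multiplier $2$ which is fixed by the Rosati involution is non-empty and has a four-dimensional component.
   Context: $U$ is the hyperbolic plane, $E_8$ the positive definite even unimodular lattice of rank $8$, $L(m)$ is $L$ with form multiplied by $m$, $L_{\mathbb{Q}}=L\otimes\mathbb{Q}$; let $q$ be the form on $\Lambda$ (signature $(2,10)$). Hodge structures of K3-type on $\Lambda$ are weight-two rational Hodge structures with $\dim\Lambda^{2,0}=1$, $\Lambda^{a,b}=0$ for $|a-b|>2$, compatible with $q$ and with $(\Lambda^{2,0}\oplus\Lambda^{0,2})\cap\Lambda_{\mathbb{R}}$ positive definite; they are parametrized by $\Omega_\Lambda=\{\omega\in\mathbb{P}(\Lambda_{\mathbb{C}})\mid q(\omega)=0,\ q(\omega,\overline{\omega})>0\}$ via $\Lambda^{2,0}=\mathbb{C}\omega$. The locus is a subset of $\Omega_\Lambda$ and dimension means complex dimension. A Hodge similarity of multiplier $2$ is an automorphism $\psi$ of the Hodge structure $\Lambda$ with $q(\psi v,\psi w)=2q(v,w)$ for all $v,w\in\Lambda$; it is fixed by the Rosati involution if $q(\psi v,w)=q(v,\psi w)$ for all $v,w\in\Lambda$. *)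

theory Defs
  imports "HOL-Analysis.Analysis"
begin

section \<open>Lattices given by Gram matrices\<close>

text \<open>
  A lattice of rank \<open>CARD('n)\<close> is given by its integral Gram matrix \<open>G\<close>; the spaces
  obtained from it by extending scalars to the rational, real and complex numbers are
  \<open>rat ^ 'n\<close>, \<open>real ^ 'n\<close> and \<open>complex ^ 'n\<close>, all carrying the form \<open>bform G\<close>
  (bilinear, not sesquilinear, over the complex numbers).
\<close>

definition bform :: "int ^ 'n ^ 'n \<Rightarrow> 'a::comm_ring_1 ^ 'n \<Rightarrow> 'a ^ 'n \<Rightarrow> 'a" where
  "bform G x y = (\<Sum>i\<in>UNIV. \<Sum>j\<in>UNIV. of_int (G $ i $ j) * x $ i * y $ j)"

definition rescale :: "int ^ 'n ^ 'n \<Rightarrow> int \<Rightarrow> int ^ 'n ^ 'n" where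
  "rescale G m = (\<chi> i j. m * G $ i $ j)"

definition orth_sum ::
  "int ^ 'm ^ 'm \<Rightarrow> int ^ 'n ^ 'n \<Rightarrow> int ^ ('m + 'n) ^ ('m + 'n)" where
  "orth_sum G H = (\<chi> i j. case (i, j) of
      (Inl a, Inl b) \<Rightarrow> G $ a $ b
    | (Inr a, Inr b) \<Rightarrow> H $ a $ b
    | _ \<Rightarrow> 0)"

definition U_lattice :: "int ^ 2 ^ 2" where
  "U_lattice = (\<chi> i j. if i = j then 0 else 1)"

text \<open>
  The Dynkin diagram of \<open>E\<^sub>8\<close> in Bourbaki's numbering of the simple roots. In the index
  type \<open>8\<close> the numerals 1, ..., 8 are pairwise distinct and exhaust the type (8 equals 0).
\<close>

definition E8_edges :: "(8 \<times> 8) set" where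
  "E8_edges = {(1, 3), (3, 4), (2, 4), (4, 5), (5, 6), (6, 7), (7, 8)}"

definition E8_lattice :: "int ^ 8 ^ 8" where
  "E8_lattice = (\<chi> i j. if i = j then 2
     else if (i, j) \<in> E8_edges \<or> (j, i) \<in> E8_edges then - 1 else 0)"

type_synonym lam = "(2 + 2) + 8"

definition Lam :: "int ^ lam ^ lam" where
  "Lam = orth_sum (orth_sum U_lattice U_lattice) (rescale E8_lattice (- 2))"

section \<open>Hodge structures of K3-type\<close>

definition vcnj :: "complex ^ 'n \<Rightarrow> complex ^ 'n" where
  "vcnj x = (\<chi> i. cnj (x $ i))"

definition complexify :: "real ^ 'n \<Rightarrow> complex ^ 'n" where
  "complexify x = (\<chi> i. complex_of_real (x $ i))"

definition complexify_map :: "(rat ^ 'n \<Rightarrow> rat ^ 'm) \<Rightarrow> complex ^ 'n \<Rightarrow> complex ^ 'm" where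
  "complexify_map \<psi> x = (\<chi> i j. of_rat (matrix \<psi> $ i $ j)) *v x"

text \<open>
  A rational Hodge structure of weight \<open>w\<close> on \<open>rat ^ 'n\<close>, given by its decomposition of
  \<open>complex ^ 'n\<close>; the third conjunct says that \<open>complex ^ 'n\<close> is the direct sum of the
  \<open>H a b\<close>.
\<close>

definition hodge_structure ::
  "int \<Rightarrow> (int \<Rightarrow> int \<Rightarrow> (complex ^ 'n) set) \<Rightarrow> bool" where
  "hodge_structure w H \<longleftrightarrow>
     (\<forall>a b. vec.subspace (H a b)) \<and>
     (\<forall>a b. a + b \<noteq> w \<longrightarrow> H a b = {0}) \<and>
     (\<forall>v. \<exists>!h. (\<forall>a b. h (a, b) \<in> H a b) \<and> finite {p. h p \<noteq> 0} \<and>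
              v = (\<Sum>p\<in>{p. h p \<noteq> 0}. h p)) \<and>
     (\<forall>a b. vcnj ` H a b = H b a)"

text \<open>
  Compatibility with the form means that it is a morphism of Hodge structures to the Tate
  structure of type (2,2).
\<close>

definition K3_type ::
  "int ^ 'n ^ 'n \<Rightarrow> (int \<Rightarrow> int \<Rightarrow> (complex ^ 'n) set) \<Rightarrow> bool" where
  "K3_type G H \<longleftrightarrow>
     hodge_structure 2 H \<and>
     vec.dim (H 2 0) = 1 \<and>
     (\<forall>a b. \<bar>a - b\<bar> > 2 \<longrightarrow> H a b = {0}) \<and>
     (\<forall>a b c d. (a + c, b + d) \<noteq> (2, 2) \<longrightarrow>
        (\<forall>x\<in>H a b. \<forall>y\<in>H c d. bform G x y = 0)) \<and>
     (\<forall>v::real ^ 'n. v \<noteq> 0 \<longrightarrow> (\<exists>x\<in>H 2 0. \<exists>y\<in>H 0 2. complexify v = x + y) \<longrightarrow>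
        bform G v v > 0)"

definition hodge_automorphism ::
  "(int \<Rightarrow> int \<Rightarrow> (complex ^ 'n) set) \<Rightarrow> (rat ^ 'n \<Rightarrow> rat ^ 'n) \<Rightarrow> bool" where
  "hodge_automorphism H \<psi> \<longleftrightarrow>
     Vector_Spaces.linear (*s) (*s) \<psi> \<and> bij \<psi> \<and>
     (\<forall>a b. complexify_map \<psi> ` H a b = H a b)"

definition hodge_similarity ::
  "int ^ 'n ^ 'n \<Rightarrow> (int \<Rightarrow> int \<Rightarrow> (complex ^ 'n) set) \<Rightarrow> rat \<Rightarrow>
     (rat ^ 'n \<Rightarrow> rat ^ 'n) \<Rightarrow> bool" where
  "hodge_similarity G H m \<psi> \<longleftrightarrow>
     hodge_automorphism H \<psi> \<and> (\<forall>v w. bform G (\<psi> v) (\<psi> w) = m * bform G v w)"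

definition rosati_fixed :: "int ^ 'n ^ 'n \<Rightarrow> (rat ^ 'n \<Rightarrow> rat ^ 'n) \<Rightarrow> bool" where
  "rosati_fixed G \<psi> \<longleftrightarrow> (\<forall>v w. bform G (\<psi> v) w = bform G v (\<psi> w))"

section \<open>Complex projective space\<close>

text \<open>
  Points are the complex lines through the origin. Topology and holomorphic functions are
  those of the quotient of the nonzero vectors by nonzero scalars.
\<close>

definition line :: "complex ^ 'n \<Rightarrow> (complex ^ 'n) set" where
  "line v = vec.span {v}"

definition proj_space :: "(complex ^ 'n) set set" where
  "proj_space = {l. vec.subspace l \<and> vec.dim l = 1}"

definition affine_cone :: "(complex ^ 'n) set set \<Rightarrow> (complex ^ 'n) set" where
  "affine_cone N = {v. v \<noteq> 0 \<and> line v \<in> N}"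

definition proj_topology :: "(complex ^ 'n) set topology" where
  "proj_topology = topology (\<lambda>N. N \<subseteq> proj_space \<and> open (affine_cone N))"

lemma openin_proj_topology:
  fixes N :: "(complex ^ 'n) set set"
  shows "openin proj_topology N \<longleftrightarrow> N \<subseteq> proj_space \<and> open (affine_cone N)"
proof -
  have 1: "affine_cone (S \<inter> T) = affine_cone S \<inter> affine_cone T" for S T :: "(complex ^ 'n) set set"
    by (auto simp: affine_cone_def)
  have 2: "affine_cone (\<Union>K) = (\<Union>N\<in>K. affine_cone N)" for K :: "(complex ^ 'n) set set set"
    by (auto simp: affine_cone_def)
  have "istopology (\<lambda>N. N \<subseteq> proj_space \<and> open (affine_cone N :: (complex ^ 'n) set))"
    unfolding istopology_def by (auto simp: 1 2)
  then show ?thesis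
    by (simp add: proj_topology_def topology_inverse')
qed

definition holomorphic_several :: "(complex ^ 'n \<Rightarrow> complex) \<Rightarrow> (complex ^ 'n) set \<Rightarrow> bool" where
  "holomorphic_several f S \<longleftrightarrow>
     open S \<and> (\<forall>x\<in>S. \<exists>D. Vector_Spaces.linear (*s) (*) D \<and> (f has_derivative D) (at x))"

definition proj_holomorphic ::
  "((complex ^ 'n) set \<Rightarrow> complex) \<Rightarrow> (complex ^ 'n) set set \<Rightarrow> bool" where
  "proj_holomorphic f N \<longleftrightarrow>
     openin proj_topology N \<and> holomorphic_several (\<lambda>v. f (line v)) (affine_cone N)"

section \<open>Analytic subsets, irreducible components, dimension\<close>

text \<open>
  \<open>W\<close> is a closed analytic subset of \<open>X\<close>. Here \<open>X\<close> is meant to be a locally closed complex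
  submanifold of projective space, so that holomorphic functions on \<open>X\<close> are locally
  restrictions of holomorphic functions on projective space.
\<close>

definition analytic_subset ::
  "(complex ^ 'n) set set \<Rightarrow> (complex ^ 'n) set set \<Rightarrow> bool" where
  "analytic_subset X W \<longleftrightarrow> W \<subseteq> X \<and>
     (\<forall>p\<in>X. \<exists>N (k::nat) f. openin proj_topology N \<and> p \<in> N \<and>
        (\<forall>i<k. proj_holomorphic (f i) N) \<and>
        W \<inter> N = {l \<in> X \<inter> N. \<forall>i<k. f i l = 0})"

text \<open>
  Near \<open>p\<close>, \<open>W\<close> is a complex submanifold of dimension \<open>d\<close>: the common zero set of \<open>k\<close>
  holomorphic functions with independent differentials at \<open>p\<close>, where
  \<open>d = (CARD('n) - 1) - k\<close>. The differentials are taken on \<open>complex ^ 'n\<close> at a vector \<open>v\<close>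
  spanning \<open>p\<close>; as they vanish on \<open>v\<close>, independence there is the same as independence on
  the tangent space of projective space.
\<close>

definition submanifold_at ::
  "(complex ^ 'n) set set \<Rightarrow> nat \<Rightarrow> (complex ^ 'n) set \<Rightarrow> bool" where
  "submanifold_at W d p \<longleftrightarrow> p \<in> W \<and>
     (\<exists>N (k::nat) f v D. d + k + 1 = CARD('n) \<and>
        openin proj_topology N \<and> p \<in> N \<and>
        (\<forall>i<k. proj_holomorphic (f i) N) \<and>
        W \<inter> N = {l \<in> N. \<forall>i<k. f i l = 0} \<and>
        v \<noteq> 0 \<and> p = line v \<and>
        (\<forall>i<k. ((\<lambda>x. f i (line x)) has_derivative D i) (at v)) \<and>
        (\<forall>c::nat \<Rightarrow> complex. (\<forall>x. (\<Sum>i<k. c i * D i x) = 0) \<longrightarrow> (\<forall>i<k. c i = 0)))"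

definition regular_locus :: "(complex ^ 'n) set set \<Rightarrow> (complex ^ 'n) set set" where
  "regular_locus W = {p. \<exists>d. submanifold_at W d p}"

text \<open>
  The irreducible components of an analytic set are the closures of the connected components
  of its regular locus, and it is irreducible if there is exactly one. (Density of the
  regular locus holds for every analytic set.)
\<close>

definition irreducible_analytic ::
  "(complex ^ 'n) set set \<Rightarrow> (complex ^ 'n) set set \<Rightarrow> bool" where
  "irreducible_analytic X W \<longleftrightarrow>
     analytic_subset X W \<and> W \<noteq> {} \<and>
     connectedin proj_topology (regular_locus W) \<and>
     W \<subseteq> proj_topology closure_of (regular_locus W)"

definition complex_dim :: "(complex ^ 'n) set set \<Rightarrow> nat" where
  "complex_dim W = Sup {d. \<exists>p. submanifold_at W d p}"

text \<open>
  The components of \<open>S\<close> are the maximal irreducible analytic subsets of \<open>X\<close> contained in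
  \<open>S\<close>. For analytic \<open>S\<close> these are its irreducible components, but the notion also applies to
  countable unions of analytic subsets that need not be closed, such as Hodge loci.
\<close>

definition locus_component ::
  "(complex ^ 'n) set set \<Rightarrow> (complex ^ 'n) set set \<Rightarrow> (complex ^ 'n) set set \<Rightarrow> bool" where
  "locus_component X S Z \<longleftrightarrow>
     irreducible_analytic X Z \<and> Z \<subseteq> S \<and>
     (\<forall>W. irreducible_analytic X W \<and> Z \<subseteq> W \<and> W \<subseteq> S \<longrightarrow> W = Z)"

section \<open>The period domain and the locus\<close>

text \<open>\<open>bform G \<omega> (vcnj \<omega>)\<close> is real whenever \<open>G\<close> is symmetric.\<close>

definition period_domain :: "int ^ 'n ^ 'n \<Rightarrow> (complex ^ 'n) set set" where
  "period_domain G = {l \<in> proj_space. \<forall>\<omega>\<in>l. \<omega> \<noteq> 0 \<longrightarrow>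
     bform G \<omega> \<omega> = 0 \<and> Re (bform G \<omega> (vcnj \<omega>)) > 0}"

definition similarity_locus :: "int ^ 'n ^ 'n \<Rightarrow> rat \<Rightarrow> (complex ^ 'n) set set" where
  "similarity_locus G m = {l \<in> period_domain G. \<exists>H. K3_type G H \<and> H 2 0 = l \<and>
     (\<exists>\<psi>. hodge_similarity G H m \<psi> \<and> rosati_fixed G \<psi>)}"

end

theory Submission
  imports Defs "HOL-Complex_Analysis.Conformal_Mappings"
begin

text \<open>
  A self-adjoint similarity \<open>\<psi>\<close> of multiplier 2 has only the real eigenvalues \<open>\<plusminus>\<surd>2\<close> on a period,
  so the locus is contained in the countable union of the linear sections
  \<open>\<P>(ker (\<psi> \<mp> \<surd>2))\<close> of the period domain over rational matrices \<open>\<psi>\<close>.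
  On \<open>\<Lambda>\<close> there is such a \<open>\<psi>\<close> whose \<open>\<surd>2\<close>-eigenspace has signature \<open>(2, 4)\<close>; its section is a
  pair of conjugate copies of the four-dimensional Lie ball, which is star-shaped.

  For maximality of one copy \<open>Z\<close>, let \<open>W \<supseteq> Z\<close> be irreducible and contained in the locus. By Baire
  and the identity theorem the connected manifold of regular points of \<open>W\<close> lies in a single
  section \<open>\<P>(ker (\<phi> - \<mu>))\<close>. As \<open>Z\<close> spans \<open>ker (\<psi> - \<surd>2)\<close>, we get \<open>(\<phi> - \<mu>) (\<psi> + \<surd>2) = 0\<close>, and
  comparing rational and irrational parts gives \<open>\<phi> = \<plusminus>\<psi>\<close>; so \<open>W\<close> lies in the same section as \<open>Z\<close>.
\<close>

section \<open>Linear functionals\<close>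

text \<open>The locus is a countable union of sections that need not be closed, so a larger
  irreducible \<open>W\<close> comes without equations that tie it to the lattice; what
  irreducibility offers is that its regular points are connected and dense. Hence the local theory
  of submanifolds comes in. Its holomorphic arguments are reduced to one variable: the Cauchy
  inequality on slices supplies the continuous derivative for the inverse function theorem, and
  analytic continuation along complex lines in straightened coordinates serves as identity theorem.
  The number four arises as follows. A rational \<open>\<psi>\<close> with square 2 on a space of
  dimension 12 has two eigenspaces of dimension 6, interchanged by the sign of sqrt 2; the periods
  in one of them are an open part of a quadric in projective 5-space. A hyperbolic plane gives a
  positive line to the sqrt 2-eigenspace and a negative line to the other, an orthonormal pair of
  \<open>E\<^sub>8\<close> (with its form made negative) gives a negative line to each. So the
  signatures are (2, 4) and (0, 6), and only the first eigenspace contains periods.\<close>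

abbreviation functional :: "(complex ^ 'n \<Rightarrow> complex) \<Rightarrow> bool" where
  "functional \<equiv> Vector_Spaces.linear (*s) (*)"

lemma functional_iff:
  "functional D \<longleftrightarrow> (\<forall>x y. D (x + y) = D x + D y) \<and> (\<forall>c x. D (c *s x) = c * D x)"
  using vec.vector_space_axioms vector_space_over_itself.vector_space_axioms
  by (auto simp: Vector_Spaces.linear_iff)

lemma functionalD:
  assumes "functional D"
  shows functional_add: "D (x + y) = D x + D y"
    and functional_scale: "D (c *s x) = c * D x"
    and functional_diff: "D (x - y) = D x - D y"
    and functional_zero: "D 0 = 0"
    and functional_sum: "D (\<Sum>i\<in>I. f i) = (\<Sum>i\<in>I. D (f i))"
proof -
  interpret Vector_Spaces.linear "(*s)" "(*)" D by fact
  show "D (x + y) = D x + D y" "D (c *s x) = c * D x" "D (x - y) = D x - D y" "D 0 = 0"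
    "D (\<Sum>i\<in>I. f i) = (\<Sum>i\<in>I. D (f i))"
    by (rule add scale diff zero sum)+
qed

lemma functional_expansion:
  fixes x :: "complex ^ 'n"
  assumes "functional D"
  shows "D x = (\<Sum>j\<in>UNIV. x $ j * D (axis j 1))"
proof -
  have "D x = D (\<Sum>j\<in>UNIV. x $ j *s axis j 1)"
    by (simp add: basis_expansion)
  also have "\<dots> = (\<Sum>j\<in>UNIV. x $ j * D (axis j 1))"
    by (simp add: functional_sum[OF assms] functional_scale[OF assms])
  finally show ?thesis .
qed

lemma scaleR_vec_conv_scale: "r *\<^sub>R (x :: complex ^ 'n) = of_real r *s x"
  by (simp add: vec_eq_iff scaleR_conv_of_real[where 'a=complex])

lemma bounded_linear_functional:
  fixes D :: "complex ^ 'n \<Rightarrow> complex"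
  assumes "functional D"
  shows "bounded_linear D"
proof -
  have "linear D"
    using assms by (intro linearI)
      (auto simp: functional_add functional_scale scaleR_vec_conv_scale scaleR_conv_of_real)
  then show ?thesis by (simp add: linear_conv_bounded_linear)
qed

lemma functional_continuous_on:
  fixes D :: "complex ^ 'n \<Rightarrow> complex"
  assumes "functional D"
  shows "continuous_on S D"
  using bounded_linear_functional[OF assms] linear_continuous_on by blast

text \<open>Induction on \<open>k\<close>: if \<open>D k\<close> vanishes on the common kernel of
  its predecessors, it gets coefficient 0; otherwise a vector \<open>u\<close> of that kernel with
  \<open>D k u \<noteq> 0\<close> tells which multiple of \<open>D k\<close> to subtract from
  \<open>E\<close> so that the predecessors suffice.\<close>

lemma functional_eq_combination_if_vanishes_on_kernels:
  fixes D :: "nat \<Rightarrow> complex ^ 'n \<Rightarrow> complex"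
  assumes "\<forall>i<k. functional (D i)" "functional E"
    and "\<And>x. \<forall>i<k. D i x = 0 \<Longrightarrow> E x = 0"
  shows "\<exists>c. \<forall>x. E x = (\<Sum>i<k. c i * D i x)"
  using assms
proof (induction k arbitrary: E)
  case 0
  then show ?case by simp
next
  case (Suc k)
  note E = \<open>functional E\<close>
  have D: "\<forall>i<k. functional (D i)" and Dk: "functional (D k)"
    using Suc.prems(1) by auto
  show ?case
  proof (cases "\<forall>x. (\<forall>i<k. D i x = 0) \<longrightarrow> D k x = 0")
    case True
    then have "\<And>x. \<forall>i<k. D i x = 0 \<Longrightarrow> E x = 0"
      using Suc.prems(3) less_Suc_eq by metis
    then obtain c where "\<forall>x. E x = (\<Sum>i<k. c i * D i x)"
      using Suc.IH[OF D E] by blast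
    then have "\<forall>x. E x = (\<Sum>i<Suc k. (c(k := 0)) i * D i x)"
      by simp
    then show ?thesis by blast
  next
    case False
    then obtain u where u: "\<forall>i<k. D i u = 0" "D k u \<noteq> 0" by blast
    define a where "a = E u / D k u"
    have F: "functional (\<lambda>x. E x - a * D k x)"
      unfolding functional_iff using E Dk
      by (simp add: functional_add functional_scale algebra_simps)
    have "E x - a * D k x = 0" if "\<forall>i<k. D i x = 0" for x
    proof -
      let ?y = "x - (D k x / D k u) *s u"
      have "\<forall>i<Suc k. D i ?y = 0"
        using that u D Dk by (auto simp: less_Suc_eq functional_diff functional_scale)
      then have "E ?y = 0" by (rule Suc.prems(3))
      then show ?thesis
        by (simp add: functional_diff[OF E] functional_scale[OF E] a_def algebra_simps)
    qed
    then obtain c where "\<forall>x. E x - a * D k x = (\<Sum>i<k. c i * D i x)"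
      using Suc.IH[OF D F] by blast
    then have "\<forall>x. E x = (\<Sum>i<Suc k. (c(k := a)) i * D i x)"
      by (simp add: algebra_simps)
    then show ?thesis by blast
  qed
qed

text \<open>If every vector killed by all \<open>D i\<close> with \<open>i \<noteq> j\<close> were
  killed by \<open>D j\<close> too, then \<open>D j\<close> would be a combination of the others,
  against independence.\<close>

lemma dual_vectors_exist:
  fixes D :: "nat \<Rightarrow> complex ^ 'n \<Rightarrow> complex"
  assumes D: "\<forall>i<k. functional (D i)"
    and ind: "\<forall>c. (\<forall>x. (\<Sum>i<k. c i * D i x) = 0) \<longrightarrow> (\<forall>i<k. c i = 0)"
  shows "\<exists>u. \<forall>i<k. \<forall>j<k. D i (u j) = (if i = j then 1 else 0)"
proof -
  have "\<exists>v. \<forall>i<k. D i v = (if i = j then 1 else 0)" if j: "j < k" for j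
  proof -
    \<comment> \<open>The \<open>j\<close>-th functional is set to zero instead of removed, which
      keeps the index range \<open>{..<k}\<close>.\<close>
    define D' where "D' i = (if i = j then (\<lambda>x. 0) else D i)" for i
    have D': "\<forall>i<k. functional (D' i)"
      using D by (auto simp: D'_def functional_iff)
    have "\<exists>x. (\<forall>i<k. D' i x = 0) \<and> D j x \<noteq> 0"
    proof (rule ccontr)
      assume "\<not> ?thesis"
      then obtain c where c: "\<forall>x. D j x = (\<Sum>i<k. c i * D' i x)"
        using functional_eq_combination_if_vanishes_on_kernels[OF D', of "D j"] D j by blast
      have "(\<Sum>i<k. (c(j := -1)) i * D i x) = 0" for x
      proof -
        have "(\<Sum>i<k. (c(j := -1)) i * D i x) = - D j x + (\<Sum>i\<in>{..<k} - {j}. c i * D i x)"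
          using j by (subst sum.remove[of _ j]) auto
        also have "(\<Sum>i\<in>{..<k} - {j}. c i * D i x) = (\<Sum>i<k. c i * D' i x)"
          using j by (subst (2) sum.remove[of _ j]) (auto simp: D'_def)
        finally show ?thesis using c by simp
      qed
      then show False
        using ind[rule_format, of "c(j := -1)" j] j by simp
    qed
    then obtain x where x: "\<forall>i<k. D' i x = 0" "D j x \<noteq> 0" by blast
    have "\<forall>i<k. D i ((1 / D j x) *s x) = (if i = j then 1 else 0)"
      using x D j by (auto simp: functional_scale D'_def split: if_splits)
    then show ?thesis by blast
  qed
  then have "\<forall>j. \<exists>v. j < k \<longrightarrow> (\<forall>i<k. D i v = (if i = j then 1 else 0))" by blast
  then obtain u where "\<forall>j<k. \<forall>i<k. D i (u j) = (if i = j then 1 else 0)"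
    by metis
  then show ?thesis by blast
qed

text \<open>In coordinates the \<open>E j\<close> become row vectors in the span of the rows of the
  \<open>D i\<close>, and Steinitz exchange bounds their number. This compares the codimensions of
  two local descriptions of one set.\<close>

lemma independent_functionals_card_le:
  fixes D :: "nat \<Rightarrow> complex ^ 'n \<Rightarrow> complex"
  assumes D: "\<forall>i<k. functional (D i)" and E: "\<forall>i<l. functional (E i)"
    and ind: "\<forall>c. (\<forall>x. (\<Sum>i<l. c i * E i x) = 0) \<longrightarrow> (\<forall>i<l. c i = 0)"
    and van: "\<And>x j. \<lbrakk>\<forall>i<k. D i x = 0; j < l\<rbrakk> \<Longrightarrow> E j x = 0"
  shows "l \<le> (k::nat)"
proof -
  define row where "row F = (\<chi> j. F (axis j 1))" for F :: "complex ^ 'n \<Rightarrow> complex"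
  have row_app: "F x = (\<Sum>j\<in>UNIV. x $ j * row F $ j)" if "functional F" for F x
    using functional_expansion[OF that, of x] by (simp add: row_def)
  have "row (E j) \<in> vec.span (row ` D ` {..<k})" if j: "j < l" for j
  proof -
    obtain c where c: "\<forall>x. E j x = (\<Sum>i<k. c i * D i x)"
      using functional_eq_combination_if_vanishes_on_kernels[OF D, of "E j"] E van j by blast
    have "row (E j) = (\<Sum>i<k. c i *s row (D i))"
      by (simp add: vec_eq_iff row_def c)
    then show ?thesis
      by (simp only:) (intro vec.span_sum vec.span_scale vec.span_base, auto)
  qed
  then have sub: "(\<lambda>j. row (E j)) ` {..<l} \<subseteq> vec.span (row ` D ` {..<k})" by auto
  have zero: "\<forall>i<l. c i = 0" if "(\<Sum>i<l. c i *s row (E i)) = 0" for c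
  proof -
    have "(\<Sum>i<l. c i * E i x) = 0" for x
    proof -
      have "(\<Sum>i<l. c i * E i x) = (\<Sum>i<l. \<Sum>j\<in>UNIV. x $ j * (c i * row (E i) $ j))"
        using E by (intro sum.cong) (auto simp: row_app[of "E _" x] sum_distrib_left algebra_simps)
      also have "\<dots> = (\<Sum>j\<in>UNIV. x $ j * (\<Sum>i<l. c i *s row (E i)) $ j)"
        by (subst sum.swap) (simp add: sum_distrib_left)
      finally show ?thesis using that by simp
    qed
    then show ?thesis using ind by blast
  qed
  \<comment> \<open>The exchange bound counts sets, so the family must be free of repetitions; two
    equal rows would be a relation with coefficients 1 and -1.\<close>
  have inj: "inj_on (\<lambda>j. row (E j)) {..<l}"
  proof (rule inj_onI, rule ccontr)
    fix i j assume ij: "i \<in> {..<l}" "j \<in> {..<l}" "row (E i) = row (E j)" "i \<noteq> j"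
    define c :: "nat \<Rightarrow> complex" where "c m = (if m = i then 1 else if m = j then -1 else 0)" for m
    have "(\<Sum>m<l. c m *s row (E m)) = (\<Sum>m\<in>{i, j}. c m *s row (E m))"
      using ij by (intro sum.mono_neutral_right) (auto simp: c_def)
    also have "\<dots> = 0" using ij by (auto simp: c_def)
    finally have "c i = 0" using zero ij by auto
    then show False by (simp add: c_def)
  qed
  have "vec.independent ((\<lambda>j. row (E j)) ` {..<l})"
  proof (rule vec.independent_if_scalars_zero)
    fix f x
    assume s: "(\<Sum>x\<in>(\<lambda>j. row (E j)) ` {..<l}. f x *s x) = 0" and x: "x \<in> (\<lambda>j. row (E j)) ` {..<l}"
    have "(\<Sum>j<l. f (row (E j)) *s row (E j)) = 0"
      using s by (simp add: sum.reindex[OF inj])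
    then show "f x = 0" using zero[of "\<lambda>j. f (row (E j))"] x by auto
  qed simp
  then have "card ((\<lambda>j. row (E j)) ` {..<l}) \<le> card (row ` D ` {..<k})"
    using vec.independent_span_bound[OF _ _ sub] by simp
  also have "\<dots> \<le> k"
    by (metis card_image_le card_lessThan finite_imageI finite_lessThan order_trans)
  finally show ?thesis by (simp add: card_image[OF inj])
qed

section \<open>Projective space\<close>

lemma line_eq: "line v = {c *s v | c. True}"
  by (auto simp: line_def vec.span_singleton)

lemma mem_line [simp]: "v \<in> line v"
  by (simp add: line_def vec.span_base)

lemma line_scale:
  assumes "c \<noteq> 0"
  shows "line (c *s v) = line v"
proof -
  have "a *s v = (a / c) *s (c *s v)" "a *s (c *s v) = (a * c) *s v" for a
    using assms by simp_all
  then show ?thesis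
    unfolding line_eq by blast
qed

lemma line_eq_line_if_mem:
  assumes "x \<in> line v" "x \<noteq> 0"
  shows "line x = line v"
proof -
  obtain c where "x = c *s v"
    using assms(1) by (auto simp: line_eq)
  with assms(2) show ?thesis
    by (auto simp: line_scale)
qed

lemma line_in_proj_space:
  assumes "v \<noteq> 0"
  shows "line v \<in> proj_space"
  using assms by (simp add: proj_space_def line_def vec.dim_singleton)

lemma proj_space_cases:
  assumes "l \<in> proj_space"
  obtains v where "v \<noteq> 0" "l = line v"
proof -
  from assms have l: "vec.subspace l" "vec.dim l = 1" by (auto simp: proj_space_def)
  then obtain B where B: "B \<subseteq> l" "vec.independent B" "l \<subseteq> vec.span B" "card B = 1"
    by (metis vec.basis_exists)
  then obtain v where v: "B = {v}" by (auto simp: card_1_singleton_iff)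
  then have "v \<noteq> 0" using B(2) vec.dependent_zero[of "{v}"] by auto
  moreover have "l = line v"
    using B v l vec.span_minimal[of B l] by (auto simp: line_def)
  ultimately show ?thesis using that by blast
qed

lemma affine_cone_iff: "v \<in> affine_cone N \<longleftrightarrow> v \<noteq> 0 \<and> line v \<in> N"
  by (simp add: affine_cone_def)

lemma topspace_proj_topology:
  "topspace proj_topology = (proj_space :: (complex ^ 'n) set set)"
proof -
  have "affine_cone proj_space = - {0 :: complex ^ 'n}"
    by (auto simp: affine_cone_iff intro: line_in_proj_space)
  then have "openin proj_topology (proj_space :: (complex ^ 'n) set set)"
    by (simp add: openin_proj_topology open_Compl)
  then show ?thesis
    by (metis openin_proj_topology openin_subset openin_topspace subset_antisym)
qed

lemma continuous_on_scale_vec [continuous_intros]: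
  "continuous_on S (\<lambda>x. (c::complex) *s (x :: complex ^ 'n))"
  unfolding vector_scalar_mult_def by (intro continuous_intros)

text \<open>The cone over the image is the union of all nonzero dilates of \<open>U\<close>.\<close>

lemma openin_proj_topology_line_image:
  assumes "open U"
  shows "openin proj_topology (line ` (U - {0}))"
proof -
  have "affine_cone (line ` (U - {0})) = (\<Union>c\<in>-{0}. (\<lambda>x. c *s x) -` (U - {0}))" (is "?L = ?R")
  proof (intro set_eqI iffI)
    fix x assume "x \<in> ?L"
    then obtain u where u: "u \<in> U" "u \<noteq> 0" "line x = line u" "x \<noteq> 0" by (auto simp: affine_cone_iff)
    then have "u \<in> line x" by simp
    then obtain c where "u = c *s x" by (auto simp: line_eq)
    then show "x \<in> ?R" using u by auto
  next
    fix x assume "x \<in> ?R"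
    then obtain c where "c \<noteq> 0" "c *s x \<in> U" "c *s x \<noteq> 0" by auto
    then show "x \<in> ?L"
      by (auto simp: affine_cone_iff intro!: image_eqI[of _ _ "c *s x"] simp: line_scale)
  qed
  moreover have "open \<dots>"
    using assms by (intro open_UN ballI open_vimage open_Diff continuous_intros) auto
  ultimately show ?thesis
    by (auto simp: openin_proj_topology intro: line_in_proj_space)
qed

section \<open>Holomorphic functions of several variables\<close>

lemma norm_scale_vec: "norm (t *s (u :: complex ^ 'n)) = cmod t * norm u"
  by (simp add: norm_vec_def norm_mult L2_set_right_distrib)

lemma bounded_linear_scale_vec: "bounded_linear (\<lambda>t. t *s (u :: complex ^ 'n))"
proof
  show "\<exists>K. \<forall>t. norm (t *s u) \<le> norm t * K"
    by (auto simp: norm_scale_vec)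
qed (simp_all add: vec_eq_iff algebra_simps)

text \<open>The definition provides some complex-linear derivative; by uniqueness any given
  \<open>D\<close> is that one.\<close>

lemma holomorphic_several_functional_derivative:
  assumes "holomorphic_several f S" "x \<in> S" "(f has_derivative D) (at x)"
  shows "functional D"
  using assms unfolding holomorphic_several_def by (metis has_derivative_unique)

lemma holomorphic_several_continuous_on:
  assumes "holomorphic_several f S"
  shows "continuous_on S f"
  using assms unfolding holomorphic_several_def
  by (meson continuous_at_imp_continuous_on has_derivative_continuous)

lemma has_field_derivative_slice:
  fixes u :: "complex ^ 'n"
  assumes "(f has_derivative D) (at (x + t *s u))" "functional D"
  shows "((\<lambda>s. f (x + s *s u)) has_field_derivative D u) (at t)"
proof -
  have "((\<lambda>s. x + s *s u) has_derivative (\<lambda>h. h *s u)) (at t)"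
    using bounded_linear.has_derivative[OF bounded_linear_scale_vec has_derivative_ident]
    by (auto intro!: derivative_eq_intros)
  from has_derivative_compose[OF this assms(1)] show ?thesis
    using assms(2) by (simp add: has_field_derivative_def functional_scale mult_commute_abs)
qed

text \<open>The Cauchy inequality on one-dimensional slices gives continuity of the derivative.\<close>

lemma holomorphic_several_continuous_derivative:
  fixes u :: "complex ^ 'n"
  assumes hol: "holomorphic_several f S"
    and D: "\<And>x. x \<in> S \<Longrightarrow> (f has_derivative D x) (at x)"
  shows "continuous_on S (\<lambda>x. D x u)"
proof (rule continuous_onI)
  fix x e assume x: "x \<in> S" and e: "(e::real) > 0"
  have "open S" using hol by (simp add: holomorphic_several_def)
  then obtain r0 where r0: "r0 > 0" "cball x r0 \<subseteq> S"
    using x open_contains_cball by blast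
  \<comment> \<open>With this radius \<open>t *s u\<close> has norm at most \<open>r0 / 2\<close>,
    which leaves the other half of \<open>r0\<close> for the distance from \<open>y\<close> to
    \<open>x\<close>; the \<open>+ 1\<close> covers \<open>u = 0\<close>.\<close>
  define r where "r = r0 / (2 * (norm u + 1))"
  have r: "r > 0" using r0 by (simp add: r_def add_nonneg_pos)
  have ru: "r * norm u \<le> r0 / 2"
  proof -
    have "r * norm u \<le> r * (norm u + 1)" using r by (intro mult_left_mono) auto
    also have "\<dots> = r0 / 2"
      by (simp add: r_def) (simp add: field_simps add_nonneg_eq_0_iff)
    finally show ?thesis .
  qed
  have "uniformly_continuous_on (cball x r0) f"
    using holomorphic_several_continuous_on[OF hol] r0
    by (intro compact_uniformly_continuous) (auto intro: continuous_on_subset)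
  then obtain \<delta> where \<delta>: "\<delta> > 0"
    "\<And>y z. \<lbrakk>y \<in> cball x r0; z \<in> cball x r0; dist z y < \<delta>\<rbrakk> \<Longrightarrow> dist (f z) (f y) < e * r / 2"
    using e r unfolding uniformly_continuous_on_def by (metis half_gt_zero mult_pos_pos)
  have mem: "y + t *s u \<in> cball x r0" if "dist y x \<le> r0 / 2" "cmod t \<le> r" for y t
  proof -
    have "dist x (y + t *s u) \<le> dist y x + norm (t *s u)"
      using dist_triangle[of x "y + t *s u" y] by (simp add: dist_commute dist_norm[of y])
    also have "norm (t *s u) \<le> r * norm u"
      using that by (simp add: norm_scale_vec mult_right_mono)
    finally show ?thesis using ru that by simp
  qed
  have "dist (D y u) (D x u) < e" if "y \<in> S" "dist y x < min \<delta> (r0 / 2)" for y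
  proof -
    \<comment> \<open>The derivative of \<open>h\<close> at 0 is the difference to be estimated;
      uniform continuity of \<open>f\<close> makes \<open>h\<close> small on the circle of radius
      \<open>r\<close>.\<close>
    define h where "h t = f (y + t *s u) - f (x + t *s u)" for t
    have slice: "((\<lambda>s. f (a + s *s u)) has_field_derivative D (a + t *s u) u) (at t)"
      if "a + t *s u \<in> S" for a t
      using has_field_derivative_slice[OF D[OF that]
          holomorphic_several_functional_derivative[OF hol that D[OF that]]] .
    have in_S: "y + t *s u \<in> S" "x + t *s u \<in> S" if "cmod t \<le> r" for t
      using mem[of y t] mem[of x t] that r0 \<open>dist y x < _\<close> by auto
    have deriv: "(h has_field_derivative D (y + t *s u) u - D (x + t *s u) u) (at t)"
      if "cmod t \<le> r" for t
      unfolding h_def using in_S[OF that] by (intro DERIV_diff slice)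
    have "cmod ((deriv ^^ 1) h 0) \<le> fact 1 * (e * r / 2) / r ^ 1"
    proof (rule Cauchy_inequality)
      show "h holomorphic_on ball 0 r"
      proof (rule holomorphic_onI)
        fix t :: complex assume "t \<in> ball 0 r"
        then show "h field_differentiable at t within ball 0 r"
          using has_field_derivative_at_within[OF deriv[of t]]
          by (auto simp: field_differentiable_def)
      qed
      show "continuous_on (cball 0 r) h"
        by (intro continuous_at_imp_continuous_on ballI) (use deriv DERIV_isCont in auto)
      fix t :: complex assume "cmod (0 - t) = r"
      then have t: "cmod t \<le> r" by simp
      have "dist (f (y + t *s u)) (f (x + t *s u)) < e * r / 2"
        using that t r0 by (intro \<delta> mem) auto
      then show "cmod (h t) \<le> e * r / 2" by (simp add: h_def dist_norm)
    qed fact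
    moreover have "deriv h 0 = D y u - D x u"
      using deriv[of 0] r by (simp add: DERIV_imp_deriv)
    ultimately have "cmod (D y u - D x u) \<le> e / 2" using r by simp
    then show ?thesis using e by (simp add: dist_norm)
  qed
  then show "\<exists>d>0. \<forall>y\<in>S. dist y x < d \<longrightarrow> dist (D y u) (D x u) \<le> e"
    using \<delta>(1) r0(1) by (intro exI[of _ "min \<delta> (r0 / 2)"]) (auto intro: less_imp_le)
qed

section \<open>Local structure of submanifolds\<close>

text \<open>
  With \<open>D i (u j) = \<delta> i j\<close>, the map \<open>F x = x - (\<Sum>i. (D i x - f i x) u i)\<close> has
  derivative \<open>id\<close> at \<open>v\<close> and satisfies \<open>D j (F x) = f j x\<close>, so it straightens the
  common zero set of the \<open>f i\<close> to the common kernel of the \<open>D i\<close>.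
\<close>

lemma local_straightening:
  fixes f :: "nat \<Rightarrow> complex ^ 'n \<Rightarrow> complex"
  assumes hol: "\<And>i. i < k \<Longrightarrow> holomorphic_several (f i) S"
    and S: "open S" "v \<in> S"
    and D: "\<And>i. i < k \<Longrightarrow> (f i has_derivative D i) (at v)"
    and ind: "\<forall>c. (\<forall>x. (\<Sum>i<k. c i * D i x) = 0) \<longrightarrow> (\<forall>i<k. c i = 0)"
  obtains U V F g where "open U" "U \<subseteq> S" "v \<in> U" "open V" "homeomorphism U V F g"
    "\<And>x i. i < k \<Longrightarrow> D i (F x) = f i x"
    "\<And>y. y \<in> V \<Longrightarrow> \<exists>D'. (g has_derivative D') (at y) \<and> (\<forall>c h. D' (c *s h) = c *s D' h)"
    "(g has_derivative (\<lambda>x. x)) (at (F v))"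
proof -
  have lin: "\<forall>i<k. functional (D i)"
    using holomorphic_several_functional_derivative[OF hol S(2) D] by blast
  obtain u where u: "\<forall>i<k. \<forall>j<k. D i (u j) = (if i = j then 1 else 0)"
    using dual_vectors_exist[OF lin ind] by blast
  \<comment> \<open>The inverse function theorem wants the derivative as a function of the point, so
    one is chosen everywhere on \<open>S\<close>; at \<open>v\<close> it is
    \<open>D i\<close>.\<close>
  define E where "E i x = (if i < k \<and> x \<in> S then (SOME E. functional E \<and> (f i has_derivative E) (at x)) else (\<lambda>_. 0))" for i x
  have E: "functional (E i x)" "(f i has_derivative E i x) (at x)" if "i < k" "x \<in> S" for i x
  proof -
    have "\<exists>E. functional E \<and> (f i has_derivative E) (at x)"
      using hol[OF that(1)] that(2) unfolding holomorphic_several_def by blast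
    from someI_ex[OF this] show "functional (E i x)" "(f i has_derivative E i x) (at x)"
      using that by (simp_all add: E_def)
  qed
  define F where "F x = x - (\<Sum>i<k. (D i x - f i x) *s u i)" for x
  define F' where "F' x h = h - (\<Sum>i<k. (D i h - E i x h) *s u i)" for x h
  have F'_der: "(F has_derivative F' x) (at x)" if "x \<in> S" for x
    unfolding F_def F'_def
    using that lin E
    by (intro has_derivative_diff has_derivative_ident has_derivative_sum
        bounded_linear.has_derivative[OF bounded_linear_scale_vec]
        bounded_linear_imp_has_derivative bounded_linear_functional) auto
  have F'_bl: "bounded_linear (F' x)" if "x \<in> S" for x
    using F'_der[OF that] has_derivative_bounded_linear by blast
  have F'_scale: "F' x (c *s h) = c *s F' x h" if "x \<in> S" for x c h
    unfolding F'_def using that lin E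
    by (simp add: functional_scale vec.scale_right_diff_distrib vec.scale_sum_right
        vec.scale_left_diff_distrib right_diff_distrib)
  have F'_v: "F' v h = h" for h
  proof -
    have "E i v = D i" if "i < k" for i
      using E[OF that S(2)] D[OF that] has_derivative_unique by blast
    then show ?thesis by (simp add: F'_def)
  qed
  \<comment> \<open>Here the continuity obtained from the Cauchy inequality enters; in finite
    dimension it can be tested on one vector at a time.\<close>
  have cont: "continuous_on S (\<lambda>x. Blinfun (F' x))"
  proof (rule continuous_on_blinfun_componentwise)
    fix b :: "complex ^ 'n"
    have "continuous_on S (\<lambda>x. F' x b)"
      unfolding F'_def
      by (intro continuous_intros bounded_linear.continuous_on[OF bounded_linear_scale_vec]
          holomorphic_several_continuous_derivative[OF hol E(2)]) auto
    then show "continuous_on S (\<lambda>x. blinfun_apply (Blinfun (F' x)) b)"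
      by (rule continuous_on_eq) (simp add: bounded_linear_Blinfun_apply F'_bl)
  qed
  have app: "blinfun_apply (Blinfun (F' x)) = F' x" if "x \<in> S" for x
    by (simp add: bounded_linear_Blinfun_apply F'_bl that)
  have der: "(F has_derivative blinfun_apply (Blinfun (F' x))) (at x)" if "x \<in> S" for x
    using F'_der app that by simp
  have inv: "id_blinfun o\<^sub>L Blinfun (F' v) = id_blinfun"
    by (rule blinfun_eqI) (simp add: app S F'_v)
  obtain U V g g' where g: "open U" "U \<subseteq> S" "v \<in> U" "open V" "F v \<in> V"
    "homeomorphism U V F g" "\<And>y. y \<in> V \<Longrightarrow> (g has_derivative (g' y)) (at y)"
    "\<And>y. y \<in> V \<Longrightarrow> g' y = inv (blinfun_apply (Blinfun (F' (g y))))"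
    "\<And>y. y \<in> V \<Longrightarrow> bij (blinfun_apply (Blinfun (F' (g y))))"
    by (rule inverse_function_theorem[OF S(1) der cont S(2) inv]) (assumption, rule that)
  have gS: "g y \<in> S" if "y \<in> V" for y
    using g(2,6) that by (auto simp: homeomorphism_def)
  have g': "g' y = inv (F' (g y))" "bij (F' (g y))" if "y \<in> V" for y
    using g(8,9)[OF that] app[OF gS[OF that]] by auto
  show ?thesis
  proof (rule that[OF g(1-4,6)])
    fix x i assume i: "i < k"
    have "D i (F x) = D i x - (\<Sum>j<k. (D j x - f j x) * D i (u j))"
      using lin i by (simp add: F_def functional_diff functional_sum functional_scale left_diff_distrib)
    also have "(\<Sum>j<k. (D j x - f j x) * D i (u j)) = (\<Sum>j<k. if j = i then D j x - f j x else 0)"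
      using u i by (intro sum.cong) auto
    finally show "D i (F x) = f i x" using i by simp
  next
    fix y assume y: "y \<in> V"
    \<comment> \<open>The inverse of the complex-linear bijection \<open>F' (g y)\<close> is again
      complex-linear.\<close>
    have "g' y (c *s h) = c *s g' y h" for c h
    proof -
      have "F' (g y) (c *s g' y h) = c *s h"
        using g'[OF y] by (simp add: F'_scale[OF gS[OF y]] bij_is_surj surj_f_inv_f)
      then show ?thesis
        using g'[OF y] by (metis bij_inv_eq_iff)
    qed
    then show "\<exists>D'. (g has_derivative D') (at y) \<and> (\<forall>c h. D' (c *s h) = c *s D' h)"
      using g(7)[OF y] by blast
  next
    have "g (F v) = v" using g(3,6) by (simp add: homeomorphism_def)
    then have "F' (g (F v)) = (\<lambda>x. x)" using F'_v by auto
    then have "g' (F v) = (\<lambda>x. x)" using g'(1)[OF g(5)] by (metis bij_id bij_inv_eq_iff eq_id_iff)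
    then show "(g has_derivative (\<lambda>x. x)) (at (F v))" using g(7)[OF g(5)] by simp
  qed
qed

text \<open>In straightened coordinates the segment \<open>F v + t *\<^sub>R x\<close> stays in the
  common kernel of the \<open>D i\<close>, so its image under \<open>g\<close> is a curve in the
  zero set of the \<open>f i\<close> through \<open>v\<close> with velocity \<open>x\<close>. As
  \<open>G\<close> vanishes along it, the chain rule gives the claim.\<close>

lemma derivative_vanishes_on_tangent_space:
  fixes f :: "nat \<Rightarrow> complex ^ 'n \<Rightarrow> complex" and G :: "complex ^ 'n \<Rightarrow> complex"
  assumes hol: "\<And>i. i < k \<Longrightarrow> holomorphic_several (f i) S"
    and S: "open S" "v \<in> S"
    and D: "\<And>i. i < k \<Longrightarrow> (f i has_derivative D i) (at v)"
    and ind: "\<forall>c. (\<forall>x. (\<Sum>i<k. c i * D i x) = 0) \<longrightarrow> (\<forall>i<k. c i = 0)"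
    and v: "\<And>i. i < k \<Longrightarrow> f i v = 0"
    and G: "(G has_derivative E) (at v)" "\<And>x. \<lbrakk>x \<in> S; \<forall>i<k. f i x = 0\<rbrakk> \<Longrightarrow> G x = 0"
    and x: "\<forall>i<k. D i x = 0"
  shows "E x = 0"
proof -
  have lin: "functional (D i)" if "i < k" for i
    using holomorphic_several_functional_derivative[OF hol S(2) D] that by blast
  obtain U V F g where g: "open U" "U \<subseteq> S" "v \<in> U" "open V" "homeomorphism U V F g"
    "\<And>x i. i < k \<Longrightarrow> D i (F x) = f i x"
    "(g has_derivative (\<lambda>x. x)) (at (F v))"
    by (rule local_straightening[OF hol S D ind]) (assumption, assumption, rule that)
  have gF: "g (F v) = v" and Fv: "F v \<in> V"
    using g(3,5) by (auto simp: homeomorphism_def)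
  have Fg: "F (g y) = y" "g y \<in> S" if "y \<in> V" for y
    using g(2,5) that by (auto simp: homeomorphism_def)
  define h where "h t = F v + t *\<^sub>R x" for t :: real
  have h: "(h has_derivative (\<lambda>t. t *\<^sub>R x)) (at 0)" "h 0 = F v"
    unfolding h_def by (auto intro!: derivative_eq_intros)
  have gh: "((\<lambda>t. g (h t)) has_derivative (\<lambda>t. t *\<^sub>R x)) (at 0)"
    using has_derivative_compose[OF h(1)] g(7) h(2) by fastforce
  have "(G has_derivative E) (at (g (h 0)))" using G(1) h(2) gF by simp
  from has_derivative_compose[OF gh this]
  have 1: "((\<lambda>t. G (g (h t))) has_derivative (\<lambda>t. E (t *\<^sub>R x))) (at 0)" .
  have "((\<lambda>t. G (g (h t))) has_derivative (\<lambda>t. 0)) (at 0)"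
  proof (rule has_derivative_transform_within_open[of "\<lambda>t. 0"])
    show "open (h -` V)"
      using g(4) unfolding h_def by (intro open_vimage) (auto intro!: continuous_intros)
    show "0 \<in> h -` V" using h(2) Fv by simp
    fix t assume "t \<in> h -` V"
    then have ht: "h t \<in> V" by simp
    have "f i (g (h t)) = 0" if i: "i < k" for i
    proof -
      have "f i (g (h t)) = D i (h t)" using g(6)[OF i, of "g (h t)"] Fg(1)[OF ht] by simp
      also have "\<dots> = D i (F v) + of_real t * D i x"
        using lin[OF i] by (simp add: h_def functional_add functional_scale scaleR_vec_conv_scale)
      also have "\<dots> = 0" using x i g(6)[OF i, of v] v[OF i] by simp
      finally show ?thesis .
    qed
    then show "0 = G (g (h t))" using G(2)[OF Fg(2)[OF ht]] by simp
  qed simp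
  from has_derivative_unique[OF 1 this] have "E (1 *\<^sub>R x) = 0" by (rule fun_cong)
  then show ?thesis by simp
qed

text \<open>On the complex line through \<open>y1\<close> and \<open>y\<close> this is a
  one-variable statement. The segment from \<open>y1\<close> to \<open>y\<close> stays in
  \<open>cball c r\<close>, so \<open>van\<close> yields zeros accumulating at parameter 0, and
  analytic continuation carries them to parameter 1. The larger radius \<open>r'\<close> provides an
  open domain.\<close>

lemma functional_identity_theorem:
  fixes g :: "complex ^ 'n \<Rightarrow> complex ^ 'n"
  assumes r': "r < r'" "ball c r' \<subseteq> V"
    and g: "\<And>y. y \<in> V \<Longrightarrow> \<exists>D'. (g has_derivative D') (at y) \<and> (\<forall>a h. D' (a *s h) = a *s D' h)"
    and L: "functional L"
    and K: "vec.subspace K"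
    and y1: "y1 \<in> K" "y1 \<in> cball c r" "e > 0"
    and van: "\<And>y. \<lbrakk>y \<in> K; y \<in> cball c r; y \<in> ball y1 e\<rbrakk> \<Longrightarrow> L (g y) = 0"
    and y: "y \<in> K" "y \<in> cball c r"
  shows "L (g y) = 0"
proof -
  define p where "p t = y1 + t *s (y - y1)" for t
  define T where "T = p -` ball c r'"
  have p_cont: "continuous_on UNIV p"
    unfolding p_def by (intro continuous_intros linear_continuous_on bounded_linear_scale_vec)
  have "open T"
    unfolding T_def using p_cont by (intro open_vimage) auto
  have "convex T"
  proof -
    have "p = (\<lambda>x. y1 + x) \<circ> (\<lambda>t. t *s (y - y1))" by (auto simp: p_def)
    then have "T = (\<lambda>t. t *s (y - y1)) -` ((\<lambda>x. y1 + x) -` ball c r')" by (auto simp: T_def)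
    also have "(\<lambda>x. y1 + x) -` ball c r' = ball (c - y1) r'"
      by (auto simp: dist_norm algebra_simps)
    finally show ?thesis
      by (simp only:) (intro convex_linear_vimage bounded_linear.linear[OF bounded_linear_scale_vec] convex_ball)
  qed
  have ends: "p 0 = y1" "p 1 = y" by (simp_all add: p_def)
  have "0 \<in> T" "1 \<in> T" using ends y y1 r' by (auto simp: T_def)
  have hol: "(\<lambda>t. L (g (p t))) holomorphic_on T"
  proof (rule holomorphic_onI)
    fix t assume "t \<in> T"
    then have "p t \<in> V" using r' by (auto simp: T_def)
    then obtain D' where D': "(g has_derivative D') (at (p t))" "\<And>a h. D' (a *s h) = a *s D' h"
      using g by blast
    have "((\<lambda>x. L (g x)) has_derivative (\<lambda>h. L (D' h))) (at (p t))"
      using bounded_linear.has_derivative[OF bounded_linear_functional[OF L] D'(1)] .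
    moreover have "functional (\<lambda>h. L (D' h))"
      using D' L has_derivative_linear[OF D'(1)]
      by (auto simp: functional_iff linear_add)
    ultimately have "((\<lambda>t. L (g (p t))) has_field_derivative L (D' (y - y1))) (at t)"
      unfolding p_def by (rule has_field_derivative_slice)
    then show "(\<lambda>t. L (g (p t))) field_differentiable at t within T"
      using field_differentiable_at_within field_differentiable_def by blast
  qed
  \<comment> \<open>Only real parameters in the unit interval are taken: for these convexity keeps
    \<open>p t\<close> in the closed ball, where \<open>van\<close> applies.\<close>
  define A :: "complex set" where "A = of_real ` {t. 0 \<le> t \<and> t \<le> 1 \<and> t * norm (y - y1) < e}"
  have p_real: "p (of_real t) = (1 - t) *\<^sub>R y1 + t *\<^sub>R y" for t
    unfolding p_def by (simp add: scaleR_vec_conv_scale[symmetric] algebra_simps)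
  have A_in: "p t \<in> K \<and> p t \<in> cball c r \<and> p t \<in> ball y1 e" if tA: "t \<in> A" for t
  proof -
    obtain s where s: "t = of_real s" "0 \<le> s" "s \<le> 1" "s * norm (y - y1) < e"
      using tA unfolding A_def by blast
    have "p t \<in> K" unfolding p_def using K y y1
      by (intro vec.subspace_add vec.subspace_scale vec.subspace_diff) auto
    moreover have "p t \<in> cball c r"
      unfolding s(1) p_real using s by (intro convexD[OF convex_cball y1(2) y(2)]) auto
    moreover have "dist y1 (p t) = s * norm (y - y1)"
    proof -
      have "dist y1 (p t) = norm (p t - y1)" by (metis dist_commute dist_norm)
      also have "\<dots> = norm (t *s (y - y1))" unfolding p_def by (simp only: add_diff_cancel_left')
      finally show ?thesis using s by (simp only: norm_scale_vec) simp
    qed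
    ultimately show ?thesis using s by simp
  qed
  have "0 islimpt A"
    unfolding islimpt_approachable
  proof (intro allI impI)
    fix \<epsilon> :: real assume "\<epsilon> > 0"
    define t where "t = min (min 1 (\<epsilon> / 2)) (e / (2 * (norm (y - y1) + 1)))"
    have n: "norm (y - y1) + 1 > 0" by (simp add: add_nonneg_pos)
    have t: "0 < t" "t \<le> 1" "t < \<epsilon>" using \<open>\<epsilon> > 0\<close> y1 n by (auto simp: t_def)
    have "t * norm (y - y1) < t * (norm (y - y1) + 1)" using t by simp
    also have "\<dots> \<le> e / (2 * (norm (y - y1) + 1)) * (norm (y - y1) + 1)"
      using n by (intro mult_right_mono) (auto simp: t_def)
    also have "\<dots> = e / 2" using n by (simp add: field_simps)
    also have "\<dots> < e" using y1 by simp
    finally have "of_real t \<in> A" using t by (auto simp: A_def)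
    then show "\<exists>x'\<in>A. x' \<noteq> 0 \<and> dist x' 0 < \<epsilon>"
      using t by (intro bexI[of _ "of_real t"]) auto
  qed
  moreover have "A \<subseteq> T"
    using A_in r' by (force simp: T_def)
  ultimately have "L (g (p 1)) = 0"
    using analytic_continuation[OF hol \<open>open T\<close> convex_connected[OF \<open>convex T\<close>], of A 0 1]
      \<open>0 \<in> T\<close> \<open>1 \<in> T\<close> A_in van by blast
  then show ?thesis by (simp add: ends)
qed

section \<open>The local dimension of a submanifold is well defined\<close>

lemma holomorphic_several_subset:
  assumes "holomorphic_several f S" "open T" "T \<subseteq> S"
  shows "holomorphic_several f T"
  using assms by (auto simp: holomorphic_several_def)

text \<open>\<open>submanifold_at\<close> may have used another spanning vector \<open>w\<close> of
  the line. Since \<open>f i (line x)\<close> is invariant under scaling, composing the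
  differentials with the dilation from \<open>v\<close> to \<open>w\<close> moves everything to
  \<open>v\<close>.\<close>

lemma submanifold_at_affine:
  fixes W :: "(complex ^ 'n) set set"
  assumes "submanifold_at W d (line v)" "v \<noteq> 0"
  obtains S k f D where "d + k + 1 = CARD('n)" "open S" "v \<in> S" "0 \<notin> S"
    "\<And>i. i < k \<Longrightarrow> holomorphic_several (f i) S"
    "\<And>x. x \<in> S \<Longrightarrow> line x \<in> W \<longleftrightarrow> (\<forall>i<k. f i x = 0)"
    "\<And>i. i < k \<Longrightarrow> (f i has_derivative D i) (at v)"
    "\<forall>c. (\<forall>x. (\<Sum>i<k. c i * D i x) = 0) \<longrightarrow> (\<forall>i<k. c i = 0)"
proof -
  obtain N k f w D where *: "d + k + 1 = CARD('n)"
    "openin proj_topology N" "line v \<in> N" "\<forall>i<k. proj_holomorphic (f i) N"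
    "W \<inter> N = {l \<in> N. \<forall>i<k. f i l = 0}" "w \<noteq> 0" "line v = line w"
    "\<forall>i<k. ((\<lambda>x. f i (line x)) has_derivative D i) (at w)"
    "\<forall>c. (\<forall>x. (\<Sum>i<k. c i * D i x) = 0) \<longrightarrow> (\<forall>i<k. c i = 0)"
    using assms(1) unfolding submanifold_at_def by blast
  have "w \<in> line v" using *(7) by simp
  then obtain a where a: "w = a *s v" by (auto simp: line_eq)
  with *(6) have a0: "a \<noteq> 0" by auto
  have scale: "((\<lambda>x. a *s x) has_derivative (\<lambda>x. a *s x)) (at v)"
  proof (rule bounded_linear_imp_has_derivative)
    show "bounded_linear (\<lambda>x :: complex ^ 'n. a *s x)"
      unfolding linear_conv_bounded_linear[symmetric]
      by (rule linearI) (simp_all add: vec_eq_iff algebra_simps)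
  qed
  show ?thesis
  proof (rule that[of k "affine_cone N" "\<lambda>i x. f i (line x)" "\<lambda>i x. D i (a *s x)"])
    fix i assume i: "i < k"
    have "((\<lambda>x. f i (line (a *s x))) has_derivative (\<lambda>x. D i (a *s x))) (at v)"
      using has_derivative_compose[OF scale] *(8) i a by blast
    then show "((\<lambda>x. f i (line x)) has_derivative (\<lambda>x. D i (a *s x))) (at v)"
      by (simp add: line_scale[OF a0])
  next
    show "\<forall>c. (\<forall>x. (\<Sum>i<k. c i * D i (a *s x)) = 0) \<longrightarrow> (\<forall>i<k. c i = 0)"
    proof (intro allI impI)
      fix c i assume c: "\<forall>x. (\<Sum>i<k. c i * D i (a *s x)) = 0" and i: "i < k"
      have "(\<Sum>i<k. c i * D i x) = 0" for x
        using c[rule_format, of "(1 / a) *s x"] a0 by simp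
      then show "c i = 0" using *(9) i by blast
    qed
  qed (use * assms in \<open>auto simp: affine_cone_iff openin_proj_topology proj_holomorphic_def\<close>)
qed

text \<open>The second system of equations vanishes on the zero set of the first near
  \<open>v\<close>, so its differentials vanish on the common kernel of the first ones; being
  independent, there are at most as many.\<close>

lemma submanifold_at_dim_le:
  fixes W :: "(complex ^ 'n) set set"
  assumes "submanifold_at W d (line v)" "submanifold_at W e (line v)" "v \<noteq> 0"
  shows "d \<le> e"
proof -
  obtain S k f D where 1: "d + k + 1 = CARD('n)" "open S" "v \<in> S" "0 \<notin> S"
    "\<And>i. i < k \<Longrightarrow> holomorphic_several (f i) S"
    "\<And>x. x \<in> S \<Longrightarrow> line x \<in> W \<longleftrightarrow> (\<forall>i<k. f i x = 0)"
    "\<And>i. i < k \<Longrightarrow> (f i has_derivative D i) (at v)"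
    "\<forall>c. (\<forall>x. (\<Sum>i<k. c i * D i x) = 0) \<longrightarrow> (\<forall>i<k. c i = 0)"
    by (rule submanifold_at_affine[OF assms(1,3)]) (rule that)
  obtain T l h E where 2: "e + l + 1 = CARD('n)" "open T" "v \<in> T" "0 \<notin> T"
    "\<And>i. i < l \<Longrightarrow> holomorphic_several (h i) T"
    "\<And>x. x \<in> T \<Longrightarrow> line x \<in> W \<longleftrightarrow> (\<forall>i<l. h i x = 0)"
    "\<And>i. i < l \<Longrightarrow> (h i has_derivative E i) (at v)"
    "\<forall>c. (\<forall>x. (\<Sum>i<l. c i * E i x) = 0) \<longrightarrow> (\<forall>i<l. c i = 0)"
    by (rule submanifold_at_affine[OF assms(2,3)]) (rule that)
  have "line v \<in> W" using assms(1) by (simp add: submanifold_at_def)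
  have "l \<le> k"
  proof (rule independent_functionals_card_le)
    show "\<forall>i<k. functional (D i)"
      using holomorphic_several_functional_derivative[OF 1(5,3,7)] by simp
    show "\<forall>i<l. functional (E i)"
      using holomorphic_several_functional_derivative[OF 2(5,3,7)] by simp
    show "\<forall>c. (\<forall>x. (\<Sum>i<l. c i * E i x) = 0) \<longrightarrow> (\<forall>i<l. c i = 0)" by fact
    fix x j assume x: "\<forall>i<k. D i x = 0" and j: "j < l"
    show "E j x = 0"
    proof (rule derivative_vanishes_on_tangent_space)
      show "holomorphic_several (f i) (S \<inter> T)" if "i < k" for i
        using 1(2,5) 2(2) that by (auto intro: holomorphic_several_subset)
      show "(h j has_derivative E j) (at v)" by (rule 2(7)[OF j])
      show "h j y = 0" if "y \<in> S \<inter> T" "\<forall>i<k. f i y = 0" for y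
        using 1(6)[of y] 2(6)[of y] that j by auto
      show "f i v = 0" if "i < k" for i
        using 1(6)[OF 1(3)] \<open>line v \<in> W\<close> that by blast
    qed (use 1 2 x in auto)
  qed
  then show ?thesis using 1(1) 2(1) by linarith
qed

lemma submanifold_at_dim_unique:
  fixes W :: "(complex ^ 'n) set set"
  assumes "submanifold_at W d p" "submanifold_at W e p"
  shows "d = e"
proof -
  obtain v where "v \<noteq> 0" "p = line v"
    using assms(1) unfolding submanifold_at_def by blast
  then show ?thesis
    using assms submanifold_at_dim_le by (metis order_antisym)
qed

section \<open>Charts, and continuation of linear equations along a submanifold\<close>

lemma subspace_common_kernel:
  assumes "\<And>i. i < k \<Longrightarrow> functional (D i)"
  shows "vec.subspace {x. \<forall>i<k. D i x = 0}"
  using assms by (auto simp: vec.subspace_def functional_add functional_scale functional_zero)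

text \<open>The inverse \<open>g\<close> of the straightening map parametrizes the cone over
  \<open>W\<close> near \<open>v\<close> by a ball in the linear space \<open>K\<close>. The closed
  ball serves the Baire argument, the open ball of twice the radius the identity theorem.\<close>

lemma submanifold_chart:
  fixes W :: "(complex ^ 'n) set set"
  assumes "submanifold_at W d p"
  obtains g :: "complex ^ 'n \<Rightarrow> complex ^ 'n" and V K c r v U where "open V" "continuous_on V g" "ball c (2 * r) \<subseteq> V" "r > 0"
    "\<And>y. y \<in> V \<Longrightarrow> \<exists>D'. (g has_derivative D') (at y) \<and> (\<forall>a h. D' (a *s h) = a *s D' h)"
    "vec.subspace K" "closed K" "c \<in> K"
    "open U" "0 \<notin> U" "v \<in> U" "p = line v"
    "\<And>x. \<lbrakk>x \<in> U; line x \<in> W\<rbrakk> \<Longrightarrow> \<exists>y\<in>K \<inter> cball c r. g y = x"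
    "\<And>y. y \<in> K \<inter> cball c r \<Longrightarrow> g y \<noteq> 0 \<and> line (g y) \<in> W"
proof -
  obtain v where v: "v \<noteq> 0" "p = line v" and pW: "p \<in> W"
    using assms unfolding submanifold_at_def by blast
  obtain S k f D where "d + k + 1 = CARD('n)" and S: "open S" "v \<in> S" "0 \<notin> S"
    and hol: "\<And>i. i < k \<Longrightarrow> holomorphic_several (f i) S"
    and zero: "\<And>x. x \<in> S \<Longrightarrow> line x \<in> W \<longleftrightarrow> (\<forall>i<k. f i x = 0)"
    and D: "\<And>i. i < k \<Longrightarrow> (f i has_derivative D i) (at v)"
    and ind: "\<forall>c. (\<forall>x. (\<Sum>i<k. c i * D i x) = 0) \<longrightarrow> (\<forall>i<k. c i = 0)"
    by (rule submanifold_at_affine[OF assms[unfolded v(2)] v(1)]) (rule that)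
  have lin: "functional (D i)" if "i < k" for i
    using holomorphic_several_functional_derivative[OF hol S(2) D] that by blast
  obtain U V F g where g: "open U" "U \<subseteq> S" "v \<in> U" "open V" "homeomorphism U V F g"
    "\<And>x i. i < k \<Longrightarrow> D i (F x) = f i x"
    "\<And>y. y \<in> V \<Longrightarrow> \<exists>D'. (g has_derivative D') (at y) \<and> (\<forall>c h. D' (c *s h) = c *s D' h)"
    by (rule local_straightening[OF hol S(1,2) D ind]) (assumption, assumption, rule that)
  have Fv: "F v \<in> V" using g(3,5) by (auto simp: homeomorphism_def)
  then obtain R where R: "R > 0" "ball (F v) R \<subseteq> V"
    using g(4) open_contains_ball by blast
  define r where "r = R / 2"
  define K where "K = {x. \<forall>i<k. D i x = 0}"
  have Fg: "F (g y) = y" "g y \<in> U" if "y \<in> V" for y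
    using g(5) that by (auto simp: homeomorphism_def)
  have gF: "g (F x) = x" if "x \<in> U" for x
    using g(5) that by (auto simp: homeomorphism_def)
  have FK: "F x \<in> K \<longleftrightarrow> line x \<in> W" if "x \<in> U" for x
    using g(2,6) zero[of x] that by (auto simp: K_def)
  show ?thesis
  proof (rule that[of V g "F v" r K "U \<inter> F -` ball (F v) r" v])
    show "continuous_on V g" using g(5) by (simp add: homeomorphism_def)
    show "closed K"
    proof -
      have "K = (\<Inter>i\<in>{..<k}. {x. D i x = 0})" by (auto simp: K_def)
      also have "closed \<dots>"
        using lin functional_continuous_on
        by (intro closed_INT ballI closed_Collect_eq) auto
      finally show ?thesis .
    qed
    show "open (U \<inter> F -` ball (F v) r)"
      using g(1,5) by (intro continuous_open_preimage) (auto simp: homeomorphism_def)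
    show "\<exists>y\<in>K \<inter> cball (F v) r. g y = x" if "x \<in> U \<inter> F -` ball (F v) r" "line x \<in> W" for x
      using that FK[of x] gF[of x] by (intro bexI[of _ "F x"]) auto
    show "g y \<noteq> 0 \<and> line (g y) \<in> W" if "y \<in> K \<inter> cball (F v) r" for y
    proof -
      have "y \<in> V" using that R by (auto simp: r_def)
      then show ?thesis using Fg[of y] FK[of "g y"] that g(2) S(3) by auto
    qed
    show "F v \<in> K" using FK[OF g(3)] pW v(2) by simp
    show "vec.subspace K" unfolding K_def by (rule subspace_common_kernel[OF lin])
  qed (use g R S v in \<open>auto simp: r_def\<close>)
qed

text \<open>Within one chart the identity theorem spreads a linear equation from any open piece of
  \<open>W\<close> to all of it. The neighbourhood \<open>N\<close> is fixed before \<open>L\<close>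
  and \<open>N'\<close>, so that it can be classified as a whole when connectedness is used.\<close>

lemma submanifold_unique_continuation:
  fixes W :: "(complex ^ 'n) set set"
  assumes "submanifold_at W d p"
  obtains N where "openin proj_topology N" "p \<in> N"
    "\<forall>L N'. functional L \<and> openin proj_topology N' \<and> N' \<inter> N \<inter> W \<noteq> {} \<and>
       (\<forall>z. z \<noteq> 0 \<and> line z \<in> N' \<inter> W \<longrightarrow> L z = 0) \<longrightarrow>
       (\<forall>x. x \<noteq> 0 \<and> line x \<in> N \<inter> W \<longrightarrow> L x = 0)"
proof -
  obtain g :: "complex ^ 'n \<Rightarrow> complex ^ 'n" and V K c r v U where V: "open V" "continuous_on V g" "ball c (2 * r) \<subseteq> V" "r > 0"
    and g: "\<And>y. y \<in> V \<Longrightarrow> \<exists>D'. (g has_derivative D') (at y) \<and> (\<forall>a h. D' (a *s h) = a *s D' h)"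
    and K: "vec.subspace K" "closed K" "c \<in> K"
    and U: "open U" "0 \<notin> U" "v \<in> U" "p = line v"
    and U_cover: "\<And>x. \<lbrakk>x \<in> U; line x \<in> W\<rbrakk> \<Longrightarrow> \<exists>y\<in>K \<inter> cball c r. g y = x"
    and gW: "\<And>y. y \<in> K \<inter> cball c r \<Longrightarrow> g y \<noteq> 0 \<and> line (g y) \<in> W"
    by (rule submanifold_chart[OF assms]) (rule that)
  have U0: "U - {0} = U" using U(2) by auto
  have N: "openin proj_topology (line ` U)"
    using openin_proj_topology_line_image[OF U(1)] by (simp only: U0)
  show ?thesis
  proof (rule that[OF N])
    show "p \<in> line ` U" using U by auto
    have "L x = 0" if L: "functional L" and N': "openin proj_topology N'" "N' \<inter> line ` U \<inter> W \<noteq> {}"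
      and van: "\<And>z. \<lbrakk>z \<noteq> 0; line z \<in> N' \<inter> W\<rbrakk> \<Longrightarrow> L z = 0"
      and x: "x \<noteq> 0" "line x \<in> line ` U \<inter> W" for L N' x
    proof -
    obtain x1 where x1: "x1 \<in> U" "line x1 \<in> N'" "line x1 \<in> W" using N'(2) by auto
    obtain y1 where y1: "y1 \<in> K" "y1 \<in> cball c r" "g y1 = x1" using U_cover[OF x1(1,3)] by auto
    obtain x2 where x2: "x2 \<in> U" "line x = line x2" "line x2 \<in> W" using x by auto
    obtain y2 where y2: "y2 \<in> K" "y2 \<in> cball c r" "g y2 = x2" using U_cover[OF x2(1,3)] by auto
    have "open (V \<inter> g -` affine_cone N')"
      using V N'(1) by (intro continuous_open_preimage) (auto simp: openin_proj_topology)
    moreover have "y1 \<in> V \<inter> g -` affine_cone N'"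
      using y1 V(3,4) x1 U(2) by (auto simp: affine_cone_iff)
    ultimately obtain e where e: "e > 0" "ball y1 e \<subseteq> V \<inter> g -` affine_cone N'"
      using open_contains_ball by blast
    have "L (g y2) = 0"
    proof (rule functional_identity_theorem[of r "2 * r" c V g L K y1 e y2])
      fix y assume "y \<in> K" "y \<in> cball c r" "y \<in> ball y1 e"
      then show "L (g y) = 0"
        using e(2) gW[of y] van[of "g y"] by (auto simp: affine_cone_iff)
    qed (use V g L K y1 y2 e in auto)
    moreover have "x \<in> line x2" using x2(2) by (metis mem_line)
    then obtain a where "x = a *s x2" by (auto simp: line_eq)
      ultimately show "L x = 0" using y2(3) by (simp add: functional_scale[OF L])
    qed
    then show "\<forall>L N'. functional L \<and> openin proj_topology N' \<and> N' \<inter> line ` U \<inter> W \<noteq> {} \<and>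
       (\<forall>z. z \<noteq> 0 \<and> line z \<in> N' \<inter> W \<longrightarrow> L z = 0) \<longrightarrow>
       (\<forall>x. x \<noteq> 0 \<and> line x \<in> line ` U \<inter> W \<longrightarrow> L x = 0)"
      by blast
  qed
qed

text \<open>\<open>T \<Phi>\<close> collects the chart points off the section \<open>\<Phi>\<close>;
  it is relatively open. If all of these were dense, Baire would give a point off every section,
  against \<open>cover\<close>. So some section fills an open piece of the chart, hence the whole
  chart by the identity theorem.\<close>

lemma submanifold_in_one_section:
  fixes W :: "(complex ^ 'n) set set"
  assumes "submanifold_at W d p" and "countable \<L>"
    and lin: "\<And>\<Phi> L. \<lbrakk>\<Phi> \<in> \<L>; L \<in> \<Phi>\<rbrakk> \<Longrightarrow> functional L"
    and cover: "\<And>x. \<lbrakk>x \<noteq> 0; line x \<in> W\<rbrakk> \<Longrightarrow> \<exists>\<Phi>\<in>\<L>. \<forall>L\<in>\<Phi>. L x = 0"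
  obtains \<Phi> N where "\<Phi> \<in> \<L>" "openin proj_topology N" "p \<in> N"
    "\<And>x L. \<lbrakk>x \<noteq> 0; line x \<in> N \<inter> W; L \<in> \<Phi>\<rbrakk> \<Longrightarrow> L x = 0"
proof -
  obtain g :: "complex ^ 'n \<Rightarrow> complex ^ 'n" and V K c r v U where V: "open V" "continuous_on V g" "ball c (2 * r) \<subseteq> V" "r > 0"
    and g: "\<And>y. y \<in> V \<Longrightarrow> \<exists>D'. (g has_derivative D') (at y) \<and> (\<forall>a h. D' (a *s h) = a *s D' h)"
    and K: "vec.subspace K" "closed K" "c \<in> K"
    and U: "open U" "0 \<notin> U" "v \<in> U" "p = line v"
    and U_cover: "\<And>x. \<lbrakk>x \<in> U; line x \<in> W\<rbrakk> \<Longrightarrow> \<exists>y\<in>K \<inter> cball c r. g y = x"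
    and gW: "\<And>y. y \<in> K \<inter> cball c r \<Longrightarrow> g y \<noteq> 0 \<and> line (g y) \<in> W"
    by (rule submanifold_chart[OF assms(1)]) (rule that)
  define S where "S = K \<inter> cball c r"
  have S: "closed S" "c \<in> S" "S \<subseteq> V"
    using K V by (auto simp: S_def closed_Int)
  define T where "T \<Phi> = (\<Union>L\<in>\<Phi>. S \<inter> (\<lambda>y. L (g y)) -` (- {0}))" for \<Phi> :: "(complex ^ 'n \<Rightarrow> complex) set"
  have "\<exists>\<Phi>\<in>\<L>. \<not> S \<subseteq> closure (T \<Phi>)"
  proof (rule ccontr)
    assume dense: "\<not> ?thesis"
    have "S \<subseteq> closure (\<Inter> (T ` \<L>))"
    proof (rule Baire)
      show "countable (T ` \<L>)" using assms(2) by simp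
      fix A assume "A \<in> T ` \<L>"
      then obtain \<Phi> where \<Phi>: "\<Phi> \<in> \<L>" "A = T \<Phi>" by auto
      have "openin (top_of_set S) (S \<inter> (\<lambda>y. L (g y)) -` (- {0}))" if "L \<in> \<Phi>" for L
      proof (rule continuous_openin_preimage_gen)
        show "continuous_on S (\<lambda>y. L (g y))"
          using continuous_on_compose2[OF functional_continuous_on[OF lin[OF \<Phi>(1) that]]
              continuous_on_subset[OF V(2) S(3)], of UNIV] by simp
      qed (simp add: open_Compl)
      then have "openin (top_of_set S) (T \<Phi>)"
        unfolding T_def by (intro openin_Union) blast
      then show "openin (top_of_set S) A \<and> S \<subseteq> closure A"
        using dense \<Phi> by auto
    qed fact
    moreover have "\<Inter> (T ` \<L>) = {}"
    proof -
      have "\<exists>\<Phi>\<in>\<L>. y \<notin> T \<Phi>" for y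
      proof (cases "y \<in> S")
        case True
        then show ?thesis using cover[of "g y"] gW[of y] by (auto simp: S_def T_def)
      next
        \<comment> \<open>No \<open>T \<Phi>\<close> contains such a \<open>y\<close>, so any member
          of \<open>\<L>\<close> will do; the centre \<open>c\<close> shows that there is
          one.\<close>
        case False
        then show ?thesis using cover[of "g c"] gW[of c] S(2) by (auto simp: S_def T_def)
      qed
      then show ?thesis by blast
    qed
    ultimately show False using S(2) by auto
  qed
  then obtain \<Phi> y1 where \<Phi>: "\<Phi> \<in> \<L>" and y1: "y1 \<in> S" "y1 \<notin> closure (T \<Phi>)" by blast
  have "open (- closure (T \<Phi>))" "y1 \<in> - closure (T \<Phi>)" using y1 by auto
  then obtain e where e: "e > 0" "ball y1 e \<subseteq> - closure (T \<Phi>)"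
    using open_contains_ball by blast
  have U0: "U - {0} = U" using U(2) by auto
  have N: "openin proj_topology (line ` U)"
    using openin_proj_topology_line_image[OF U(1)] by (simp only: U0)
  show ?thesis
  proof (rule that[OF \<Phi> N])
    show "p \<in> line ` U" using U by auto
    fix x L assume x: "x \<noteq> 0" "line x \<in> line ` U \<inter> W" and L: "L \<in> \<Phi>"
    note funL = lin[OF \<Phi> L]
    obtain x2 where x2: "x2 \<in> U" "line x = line x2" "line x2 \<in> W" using x by auto
    obtain y2 where y2: "y2 \<in> K" "y2 \<in> cball c r" "g y2 = x2" using U_cover[OF x2(1,3)] by auto
    have "L (g y2) = 0"
    proof (rule functional_identity_theorem[of r "2 * r" c V g L K y1 e y2])
      fix y assume y: "y \<in> K" "y \<in> cball c r" "y \<in> ball y1 e"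
      then have "y \<notin> T \<Phi>" using e(2) closure_subset by blast
      then show "L (g y) = 0" using y L by (auto simp: T_def S_def)
    qed (use V g funL K y1 y2 e in \<open>auto simp: S_def\<close>)
    moreover have "x \<in> line x2" using x2(2) by (metis mem_line)
    then obtain a where "x = a *s x2" by (auto simp: line_eq)
    ultimately show "L x = 0" using y2(3) by (simp add: functional_scale[OF funL])
  qed
qed

text \<open>One regular point fixes \<open>\<Phi>\<close>. The regular points near which
  \<open>W\<close> lies in this section form an open and closed part of the connected regular locus,
  and density extends the equations to all of \<open>W\<close>.\<close>

lemma irreducible_in_one_section:
  fixes W :: "(complex ^ 'n) set set"
  assumes irr: "irreducible_analytic X W" and "countable \<L>"
    and lin: "\<And>\<Phi> L. \<lbrakk>\<Phi> \<in> \<L>; L \<in> \<Phi>\<rbrakk> \<Longrightarrow> functional L"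
    and cover: "\<And>x. \<lbrakk>x \<noteq> 0; line x \<in> W\<rbrakk> \<Longrightarrow> \<exists>\<Phi>\<in>\<L>. \<forall>L\<in>\<Phi>. L x = 0"
  obtains \<Phi> where "\<Phi> \<in> \<L>" "\<And>x L. \<lbrakk>x \<noteq> 0; line x \<in> W; L \<in> \<Phi>\<rbrakk> \<Longrightarrow> L x = 0"
proof -
  let ?R = "regular_locus W"
  have conn: "connectedin proj_topology ?R" and dense: "W \<subseteq> proj_topology closure_of ?R" and "W \<noteq> {}"
    using irr by (auto simp: irreducible_analytic_def)
  then have "?R \<noteq> {}" by auto
  have RW: "?R \<subseteq> W" by (auto simp: regular_locus_def submanifold_at_def)
  obtain p d where p: "p \<in> ?R" "submanifold_at W d p"
    using \<open>?R \<noteq> {}\<close> by (auto simp: regular_locus_def)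
  obtain \<Phi> N where \<Phi>: "\<Phi> \<in> \<L>" and N: "openin proj_topology N" "p \<in> N"
    "\<And>x L. \<lbrakk>x \<noteq> 0; line x \<in> N \<inter> W; L \<in> \<Phi>\<rbrakk> \<Longrightarrow> L x = 0"
  proof (rule submanifold_in_one_section[OF p(2) assms(2)])
    show "functional L" if "\<Phi> \<in> \<L>" "L \<in> \<Phi>" for \<Phi> L
      using lin that .
    show "\<exists>\<Phi>\<in>\<L>. \<forall>L\<in>\<Phi>. L x = 0" if "x \<noteq> 0" "line x \<in> W" for x
      using cover that .
  qed (rule that)
  define good where "good N \<longleftrightarrow> openin proj_topology N \<and>
    (\<forall>x. x \<noteq> 0 \<and> line x \<in> N \<inter> W \<longrightarrow> (\<forall>L\<in>\<Phi>. L x = 0))" for N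
  \<comment> \<open>Separation from every good set makes the two unions disjoint on \<open>W\<close>
    by definition; unique continuation shows that they cover the regular locus.\<close>
  define bad where "bad N \<longleftrightarrow> openin proj_topology N \<and>
    (\<forall>N'. good N' \<longrightarrow> N' \<inter> N \<inter> W = {})" for N
  have 1: "openin proj_topology (\<Union>{N. good N})" "openin proj_topology (\<Union>{N. bad N})"
    by (auto simp: good_def bad_def)
  have 2: "?R \<subseteq> \<Union>{N. good N} \<union> \<Union>{N. bad N}"
  proof
    fix q assume "q \<in> ?R"
    then obtain e where e: "submanifold_at W e q" by (auto simp: regular_locus_def)
    obtain N where N: "openin proj_topology N" "q \<in> N"
      "\<forall>L N'. functional L \<and> openin proj_topology N' \<and> N' \<inter> N \<inter> W \<noteq> {} \<and>
       (\<forall>z. z \<noteq> 0 \<and> line z \<in> N' \<inter> W \<longrightarrow> L z = 0) \<longrightarrow>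
       (\<forall>x. x \<noteq> 0 \<and> line x \<in> N \<inter> W \<longrightarrow> L x = 0)"
      by (rule submanifold_unique_continuation[OF e]) (rule that)
    show "q \<in> \<Union>{N. good N} \<union> \<Union>{N. bad N}"
    proof (cases "bad N")
      case True
      then show ?thesis using N(2) by auto
    next
      case False
      then obtain N' where N': "good N'" "N' \<inter> N \<inter> W \<noteq> {}" using N(1) by (auto simp: bad_def)
      have "L x = 0" if "x \<noteq> 0" "line x \<in> N \<inter> W" "L \<in> \<Phi>" for x L
      proof -
        have "functional L \<and> openin proj_topology N' \<and> N' \<inter> N \<inter> W \<noteq> {} \<and>
          (\<forall>z. z \<noteq> 0 \<and> line z \<in> N' \<inter> W \<longrightarrow> L z = 0)"
          using N' lin[OF \<Phi> that(3)] that(3) by (auto simp: good_def)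
        from N(3)[rule_format, OF this] show ?thesis using that by blast
      qed
      then have "good N" using N(1) by (auto simp: good_def)
      then show ?thesis using N(2) by auto
    qed
  qed
  have 3: "\<Union>{N. good N} \<inter> \<Union>{N. bad N} \<inter> ?R = {}"
    using RW by (auto simp: bad_def)
  have 4: "\<Union>{N. good N} \<inter> ?R \<noteq> {}"
  proof -
    have "good N" using N by (auto simp: good_def)
    then show ?thesis using N(2) p(1) by auto
  qed
  have "\<Union>{N. bad N} \<inter> ?R = {}"
    using conn[unfolded connectedin] 1 2 3 4 by blast
  then have R_good: "?R \<subseteq> \<Union>{N. good N}" using 2 by blast
  show ?thesis
  proof (rule that[OF \<Phi>], rule ccontr)
    fix x L assume x: "x \<noteq> 0" "line x \<in> W" and L: "L \<in> \<Phi>" "L x \<noteq> 0"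
    note funL = lin[OF \<Phi> L(1)]
    \<comment> \<open>A point of \<open>W\<close> with \<open>L x \<noteq> 0\<close> has a whole
      neighbourhood of such points, and by density this contains a regular one.\<close>
    have "open {x. L x \<noteq> 0}"
      using functional_continuous_on[OF funL] by (intro open_Collect_neq) auto
    then have "openin proj_topology (line ` ({x. L x \<noteq> 0} - {0}))"
      by (rule openin_proj_topology_line_image)
    moreover have "line x \<in> line ` ({x. L x \<noteq> 0} - {0})" using x L by auto
    ultimately obtain q where q: "q \<in> ?R" "q \<in> line ` ({x. L x \<noteq> 0} - {0})"
      using dense x(2) unfolding in_closure_of by (meson in_closure_of subsetD)
    then obtain z where z: "q = line z" "L z \<noteq> 0" "z \<noteq> 0" by auto
    then show False using R_good q(1) RW L(1) unfolding good_def by blast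
  qed
qed

section \<open>Bilinear forms\<close>

lemma bform_add_left: "bform G (x + y) z = bform G x z + bform G y z"
  and bform_add_right: "bform G z (x + y) = bform G z x + bform G z y"
  by (simp_all add: bform_def algebra_simps sum.distrib)

lemma bform_scale_left: "bform G (c *s x) y = c * bform G x y"
  and bform_scale_right: "bform G x (c *s y) = c * bform G x y"
  by (simp_all add: bform_def sum_distrib_left algebra_simps)

lemma bform_zero_left [simp]: "bform G 0 y = 0"
  and bform_zero_right [simp]: "bform G x 0 = 0"
  by (simp_all add: bform_def)

lemma bform_diff_left: "bform G (x - y) z = bform G x z - bform G y z"
  by (simp add: bform_def algebra_simps sum_subtractf)

lemma bform_sym:
  assumes "\<And>i j. G $ i $ j = G $ j $ i"
  shows "bform G x y = bform G y x"
proof -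
  have "bform G x y = (\<Sum>i\<in>UNIV. \<Sum>j\<in>UNIV. of_int (G $ j $ i) * x $ j * y $ i)"
    unfolding bform_def by (rule sum.swap)
  also have "\<dots> = bform G y x"
  proof -
    have "of_int (G $ j $ i) * x $ j * y $ i = of_int (G $ i $ j) * y $ i * x $ j" for i j
      by (simp add: assms[of i j] mult.assoc mult.commute)
    then show ?thesis by (simp add: bform_def)
  qed
  finally show ?thesis .
qed

lemma bform_vcnj: "bform G (vcnj x) (vcnj y) = cnj (bform G x y)"
  by (simp add: bform_def vcnj_def)

lemma vcnj_vcnj [simp]: "vcnj (vcnj x) = x"
  by (simp add: vcnj_def vec_eq_iff)

lemma vcnj_scale: "vcnj (c *s x) = cnj c *s vcnj x"
  and vcnj_add: "vcnj (x + y) = vcnj x + vcnj y"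
  and vcnj_0 [simp]: "vcnj 0 = 0"
  by (simp_all add: vcnj_def vec_eq_iff)

section \<open>Complexification of rational maps\<close>

definition rat_vec :: "rat ^ 'n \<Rightarrow> complex ^ 'n" where
  "rat_vec x = (\<chi> i. of_rat (x $ i))"

lemma rat_vec_axis: "rat_vec (axis i 1) = axis i 1"
  by (simp add: rat_vec_def axis_def vec_eq_iff)

lemma bform_rat_vec: "bform G (rat_vec x) (rat_vec y) = of_rat (bform G x y)"
  by (simp add: bform_def rat_vec_def of_rat_sum of_rat_mult)

lemma complexify_map_add: "complexify_map \<psi> (x + y) = complexify_map \<psi> x + complexify_map \<psi> y"
  and complexify_map_scale: "complexify_map \<psi> (c *s x) = c *s complexify_map \<psi> x"
  by (simp_all add: complexify_map_def matrix_vector_right_distrib vector_scalar_commute)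

lemma complexify_map_vcnj: "complexify_map \<psi> (vcnj x) = vcnj (complexify_map \<psi> x)"
proof -
  have "cnj (of_rat q) = of_rat q" for q
    by (cases q) (simp add: of_rat_rat)
  then show ?thesis
    by (simp add: complexify_map_def vcnj_def matrix_vector_mult_def vec_eq_iff)
qed

lemma complexify_map_rat_vec:
  assumes "Vector_Spaces.linear (*s) (*s) \<psi>"
  shows "complexify_map \<psi> (rat_vec x) = rat_vec (\<psi> x)"
proof -
  have "\<psi> x = matrix \<psi> *v x" by (simp add: matrix_works assms)
  then show ?thesis
    by (simp add: complexify_map_def rat_vec_def matrix_vector_mult_def vec_eq_iff of_rat_sum of_rat_mult)
qed

text \<open>Rational vectors suffice because the standard basis consists of them.\<close>

lemma complex_linear_eqI:
  fixes f g :: "complex ^ 'n \<Rightarrow> complex ^ 'm"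
  assumes "\<And>x y. f (x + y) = f x + f y" "\<And>c x. f (c *s x) = c *s f x"
    and "\<And>x y. g (x + y) = g x + g y" "\<And>c x. g (c *s x) = c *s g x"
    and "\<And>v. f (rat_vec v) = g (rat_vec v)"
  shows "f x = g x"
proof -
  have "f x $ k = g x $ k" for k
  proof -
    have "functional (\<lambda>x. f x $ k)" "functional (\<lambda>x. g x $ k)"
      by (simp_all add: functional_iff assms(1-4))
    from this[THEN functional_expansion, of x] show ?thesis
      using assms(5)[of "axis _ 1"] by (simp add: rat_vec_axis)
  qed
  then show ?thesis by (simp add: vec_eq_iff)
qed

lemma complexify_map_id: "complexify_map (\<lambda>x. x) x = x"
  by (rule complex_linear_eqI[where f = "complexify_map (\<lambda>x. x)" and g = "\<lambda>x. x"])
    (simp_all add: complexify_map_add complexify_map_scale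
      complexify_map_rat_vec[OF vec.linear_id, unfolded id_def])

text \<open>Both sides are bilinear and agree on the standard basis. With four maps one identity
  covers the multiplier condition and self-adjointness, by putting identities in suitable
  places.\<close>

lemma complexify_bform_identity:
  fixes \<phi> \<psi> \<phi>' \<psi>' :: "rat ^ 'n \<Rightarrow> rat ^ 'n"
  assumes lin: "Vector_Spaces.linear (*s) (*s) \<phi>" "Vector_Spaces.linear (*s) (*s) \<psi>"
      "Vector_Spaces.linear (*s) (*s) \<phi>'" "Vector_Spaces.linear (*s) (*s) \<psi>'"
    and eq: "\<And>v w. bform G (\<phi> v) (\<psi> w) = m * bform G (\<phi>' v) (\<psi>' w)"
  shows "bform G (complexify_map \<phi> x) (complexify_map \<psi> y) =
    of_rat m * bform G (complexify_map \<phi>' x) (complexify_map \<psi>' y)"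
proof -
  have expand: "bform G (complexify_map \<alpha> x) (complexify_map \<beta> y) =
      (\<Sum>i\<in>UNIV. x $ i * (\<Sum>j\<in>UNIV. y $ j * of_rat (bform G (\<alpha> (axis i 1)) (\<beta> (axis j 1)))))"
    if "Vector_Spaces.linear (*s) (*s) \<alpha>" "Vector_Spaces.linear (*s) (*s) \<beta>"
    for \<alpha> \<beta> :: "rat ^ 'n \<Rightarrow> rat ^ 'n"
  proof -
    have 1: "functional (\<lambda>x. bform G (complexify_map \<alpha> x) z)" for z
      by (simp add: functional_iff complexify_map_add complexify_map_scale bform_add_left bform_scale_left)
    have 2: "functional (\<lambda>y. bform G z (complexify_map \<beta> y))" for z
      by (simp add: functional_iff complexify_map_add complexify_map_scale bform_add_right bform_scale_right)
    have "bform G (complexify_map \<alpha> x) (complexify_map \<beta> y) =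
        (\<Sum>i\<in>UNIV. x $ i * bform G (complexify_map \<alpha> (axis i 1)) (complexify_map \<beta> y))"
      by (rule functional_expansion[OF 1])
    also have "\<dots> = (\<Sum>i\<in>UNIV. x $ i * (\<Sum>j\<in>UNIV. y $ j *
        bform G (complexify_map \<alpha> (axis i 1)) (complexify_map \<beta> (axis j 1))))"
      by (intro sum.cong refl arg_cong[where f = "(*) _"] functional_expansion[OF 2])
    also have "\<dots> = (\<Sum>i\<in>UNIV. x $ i * (\<Sum>j\<in>UNIV. y $ j * of_rat (bform G (\<alpha> (axis i 1)) (\<beta> (axis j 1)))))"
      by (simp only: rat_vec_axis[symmetric] complexify_map_rat_vec that bform_rat_vec)
    finally show ?thesis .
  qed
  show ?thesis
    unfolding expand[OF lin(1,2)] expand[OF lin(3,4)] eq of_rat_mult sum_distrib_left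
    by (simp only: mult.assoc mult.commute mult.left_commute)
qed

section \<open>The Hodge structure of a period\<close>

lemma line_in_period_domain_iff:
  assumes "x \<noteq> 0"
  shows "line x \<in> period_domain G \<longleftrightarrow> bform G x x = 0 \<and> Re (bform G x (vcnj x)) > 0"
proof
  assume "line x \<in> period_domain G"
  then show "bform G x x = 0 \<and> Re (bform G x (vcnj x)) > 0"
    using assms mem_line[of x] by (auto simp: period_domain_def)
next
  assume *: "bform G x x = 0 \<and> Re (bform G x (vcnj x)) > 0"
  have "bform G (c *s x) (c *s x) = 0 \<and> Re (bform G (c *s x) (vcnj (c *s x))) > 0" if "c \<noteq> 0" for c
  proof -
    have "bform G (c *s x) (vcnj (c *s x)) = of_real ((cmod c)\<^sup>2) * bform G x (vcnj x)"
      by (simp add: bform_scale_left bform_scale_right vcnj_scale complex_norm_square del: of_real_power)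
    then have "Re (bform G (c *s x) (vcnj (c *s x))) = (cmod c)\<^sup>2 * Re (bform G x (vcnj x))"
      by simp
    then show ?thesis using * that by (simp add: bform_scale_left bform_scale_right)
  qed
  then show "line x \<in> period_domain G"
    using line_in_proj_space[OF assms] by (auto simp: period_domain_def line_eq)
qed

text \<open>The only candidate for a given \<open>H 2 0\<close>: conjugation dictates
  \<open>H 0 2\<close>, and compatibility with the form makes \<open>H 1 1\<close> orthogonal to
  both.\<close>

definition hodge_of :: "int ^ 'n ^ 'n \<Rightarrow> complex ^ 'n \<Rightarrow> int \<Rightarrow> int \<Rightarrow> (complex ^ 'n) set" where
  "hodge_of G \<omega> a b =
    (if a = 2 \<and> b = 0 then line \<omega>
     else if a = 0 \<and> b = 2 then line (vcnj \<omega>)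
     else if a = 1 \<and> b = 1 then {x. bform G x \<omega> = 0 \<and> bform G x (vcnj \<omega>) = 0}
     else {0})"

lemma subspace_line: "vec.subspace (line v)"
  by (simp add: line_def)

text \<open>\<open>\<omega>\<close> and \<open>vcnj \<omega>\<close> are isotropic with nonzero real
  pairing \<open>n\<close>, so they span a nondegenerate plane, which splits off its orthogonal
  complement \<open>H 1 1\<close>.\<close>

lemma K3_type_hodge_of:
  fixes \<omega> :: "complex ^ 'n"
  assumes sym: "\<And>i j. G $ i $ j = G $ j $ i"
    and isotropic: "bform G \<omega> \<omega> = 0" and pos: "Re (bform G \<omega> (vcnj \<omega>)) > 0"
  shows "K3_type G (hodge_of G \<omega>)"
proof -
  let ?H = "hodge_of G \<omega>"
  define n where "n = bform G \<omega> (vcnj \<omega>)"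
  have "n \<noteq> 0" using pos by (auto simp: n_def)
  have n': "bform G (vcnj \<omega>) \<omega> = n" using bform_sym[OF sym] by (simp add: n_def)
  have n_cnj: "cnj n = n"
    using bform_vcnj[of G \<omega> "vcnj \<omega>"] n' by (simp add: n_def)
  have iso': "bform G (vcnj \<omega>) (vcnj \<omega>) = 0" by (simp add: bform_vcnj isotropic)
  have "\<omega> \<noteq> 0" using \<open>n \<noteq> 0\<close> by (auto simp: n_def)
  note q = isotropic iso' n' n_def[symmetric]
  have sub: "vec.subspace (?H a b)" for a b
  proof -
    have "vec.subspace {x. bform G x \<omega> = 0 \<and> bform G x (vcnj \<omega>) = 0}"
      by (simp add: vec.subspace_def bform_add_left bform_scale_left)
    then show ?thesis by (simp add: hodge_of_def subspace_line vec.subspace_single_0)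
  qed
  have off: "?H a b = {0}" if "(a, b) \<notin> {(2, 0), (0, 2), (1, 1)}" for a b
    using that by (auto simp: hodge_of_def)
  have decomp: "finite {p. h p \<noteq> 0} \<and> (\<Sum>p\<in>{p. h p \<noteq> 0}. h p) = h (2, 0) + h (0, 2) + h (1, 1)"
    if "\<forall>a b. h (a, b) \<in> ?H a b" for h
  proof -
    have "h p = 0" if "p \<notin> {(2, 0), (0, 2), (1, 1)}" for p
      using off[of "fst p" "snd p"] that \<open>\<forall>a b. h (a, b) \<in> ?H a b\<close>
      by (metis prod.collapse singletonD)
    then have s: "{p. h p \<noteq> 0} \<subseteq> {(2, 0), (0, 2), (1, 1)}" by blast
    then have "(\<Sum>p\<in>{p. h p \<noteq> 0}. h p) = (\<Sum>p\<in>{(2, 0), (0, 2), (1, 1)}. h p)"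
      by (intro sum.mono_neutral_left) auto
    then show ?thesis using finite_subset[OF s] by (simp add: add.assoc)
  qed
  have ex1: "\<exists>!h. (\<forall>a b. h (a, b) \<in> ?H a b) \<and> finite {p. h p \<noteq> 0} \<and>
              v = (\<Sum>p\<in>{p. h p \<noteq> 0}. h p)" for v
  proof
    \<comment> \<open>Each coefficient is read off by pairing with the opposite isotropic
      vector.\<close>
    define x where "x = bform G v (vcnj \<omega>) / n"
    define y where "y = bform G v \<omega> / n"
    define h where "h p = (if p = (2, 0) then x *s \<omega> else if p = (0, 2) then y *s vcnj \<omega>
      else if p = (1, 1) then v - x *s \<omega> - y *s vcnj \<omega> else 0)" for p :: "int \<times> int"
    have "\<forall>a b. h (a, b) \<in> ?H a b"
      using \<open>n \<noteq> 0\<close>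
      by (auto simp: h_def hodge_of_def line_eq bform_diff_left bform_scale_left q x_def y_def)
    with decomp[OF this]
    show "(\<forall>a b. h (a, b) \<in> ?H a b) \<and> finite {p. h p \<noteq> 0} \<and> v = (\<Sum>p\<in>{p. h p \<noteq> 0}. h p)"
      by (simp add: h_def)
    fix h' assume h': "(\<forall>a b. h' (a, b) \<in> ?H a b) \<and> finite {p. h' p \<noteq> 0} \<and>
      v = (\<Sum>p\<in>{p. h' p \<noteq> 0}. h' p)"
    then have v: "v = h' (2, 0) + h' (0, 2) + h' (1, 1)" using decomp by metis
    have mem: "h' (2, 0) \<in> line \<omega>" "h' (0, 2) \<in> line (vcnj \<omega>)"
      "bform G (h' (1, 1)) \<omega> = 0" "bform G (h' (1, 1)) (vcnj \<omega>) = 0"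
      using h'[THEN conjunct1, rule_format, of 2 0] h'[THEN conjunct1, rule_format, of 0 2]
        h'[THEN conjunct1, rule_format, of 1 1] by (auto simp: hodge_of_def)
    obtain x' y' where xy: "h' (2, 0) = x' *s \<omega>" "h' (0, 2) = y' *s vcnj \<omega>"
      using mem(1,2) by (auto simp: line_eq)
    have "x' = x"
      unfolding x_def by (subst v) (simp add: xy bform_add_left bform_scale_left q mem \<open>n \<noteq> 0\<close>)
    moreover have "y' = y"
      unfolding y_def by (subst v) (simp add: xy bform_add_left bform_scale_left q mem \<open>n \<noteq> 0\<close>)
    moreover have "h' (1, 1) = v - x' *s \<omega> - y' *s vcnj \<omega>"
      by (subst v) (simp add: xy)
    moreover have "h' p = 0" if "p \<notin> {(2, 0), (0, 2), (1, 1)}" for p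
      using off[of "fst p" "snd p"] that h' by (metis prod.collapse singletonD)
    ultimately show "h' = h" by (auto simp: h_def xy)
  qed
  have cnj_line: "vcnj ` line x = line (vcnj x)" for x :: "complex ^ 'n"
  proof -
    have "range (\<lambda>c. cnj c *s vcnj x) = range (\<lambda>c. c *s vcnj x)"
    proof (intro equalityI subsetI)
      fix y assume "y \<in> range (\<lambda>c. c *s vcnj x)"
      then obtain c where "y = cnj (cnj c) *s vcnj x" by auto
      then show "y \<in> range (\<lambda>c. cnj c *s vcnj x)" by blast
    qed auto
    then show ?thesis by (simp add: line_eq full_SetCompr_eq image_image vcnj_scale)
  qed
  have cnj: "vcnj ` ?H a b = ?H b a" for a b
  proof -
    have "vcnj ` {x. bform G x \<omega> = 0 \<and> bform G x (vcnj \<omega>) = 0} =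
        {x. bform G x \<omega> = 0 \<and> bform G x (vcnj \<omega>) = 0}" (is "_ ` ?K = _")
    proof -
      have *: "vcnj x \<in> ?K" if "x \<in> ?K" for x
        using that bform_vcnj[of G x \<omega>] bform_vcnj[of G x "vcnj \<omega>"] by simp
      show ?thesis
        using * image_eqI[of _ vcnj "vcnj _" ?K] by (auto simp del: mem_Collect_eq)
    qed
    then show ?thesis by (auto simp: hodge_of_def cnj_line)
  qed
  have hodge: "hodge_structure 2 ?H"
    unfolding hodge_structure_def using sub ex1 cnj off by auto
  have dim: "vec.dim (?H 2 0) = 1"
    using line_in_proj_space[OF \<open>\<omega> \<noteq> 0\<close>] by (simp add: hodge_of_def proj_space_def)
  have orth: "bform G x y = 0"
    if ne: "(a + c, b + d) \<noteq> (2, 2)" and x: "x \<in> ?H a b" and y: "y \<in> ?H c d" for a b c d x y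
  proof (cases "x = 0 \<or> y = 0")
    case True
    then show ?thesis by auto
  next
    case False
    have "(a, b) \<in> {(2, 0), (0, 2), (1, 1)}" "(c, d) \<in> {(2, 0), (0, 2), (1, 1)}"
      using off x y False by blast+
    then show ?thesis
      using ne x y bform_sym[OF sym, of x y] q
      by (auto simp: hodge_of_def line_eq bform_scale_left bform_scale_right)
  qed
  have posdef: "bform G v v > 0"
    if h: "v \<noteq> 0" "x \<in> ?H 2 0" "y \<in> ?H 0 2" "complexify v = x + y" for v :: "real ^ 'n" and x y
  proof -
    obtain a b where ab: "x = a *s \<omega>" "y = b *s vcnj \<omega>"
      using h(2,3) by (auto simp: hodge_of_def line_eq)
    \<comment> \<open>Reality of \<open>v\<close> makes the two coefficients conjugate, so the form
      takes the value \<open>2 * (cmod a)\<^sup>2 * n\<close> on it.\<close>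
    have "vcnj (complexify v) = complexify v" by (simp add: vcnj_def complexify_def)
    then have eq: "cnj a *s vcnj \<omega> + cnj b *s \<omega> = a *s \<omega> + b *s vcnj \<omega>"
      by (simp add: that(4) ab vcnj_add vcnj_scale)
    have "bform G (cnj a *s vcnj \<omega> + cnj b *s \<omega>) \<omega> = bform G (a *s \<omega> + b *s vcnj \<omega>) \<omega>"
      by (simp only: eq)
    then have b: "b = cnj a"
      using \<open>n \<noteq> 0\<close> by (simp add: bform_add_left bform_scale_left q)
    have "of_real (bform G v v) = bform G (complexify v) (complexify v)"
      by (simp add: bform_def complexify_def)
    also have "\<dots> = 2 * (a * cnj a) * n"
      unfolding that(4) ab b
      by (simp add: bform_add_left bform_add_right bform_scale_left bform_scale_right q)
    also have "\<dots> = of_real (2 * (cmod a)\<^sup>2) * n" by (simp add: complex_norm_square[symmetric])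
    finally have "Re (of_real (bform G v v)) = Re (of_real (2 * (cmod a)\<^sup>2) * n)" by (rule arg_cong)
    then have "bform G v v = 2 * (cmod a)\<^sup>2 * Re n" by simp
    moreover have "a \<noteq> 0"
    proof
      assume "a = 0"
      then have "complexify v = 0" using that(4) ab b by simp
      then show False using that(1) by (simp add: complexify_def vec_eq_iff)
    qed
    ultimately show ?thesis using pos by (simp add: n_def)
  qed
  show ?thesis
    unfolding K3_type_def
  proof (intro conjI allI impI ballI hodge dim)
    show "?H a b = {0}" if "\<bar>a - b\<bar> > 2" for a b
      using that by (intro off) auto
  next
    fix a b c d x y assume "(a + c, b + d) \<noteq> (2, 2)" "x \<in> ?H a b" "y \<in> ?H c d"
    then show "bform G x y = 0" by (rule orth)
  next
    fix v :: "real ^ 'n" assume v: "v \<noteq> 0" "\<exists>x\<in>?H 2 0. \<exists>y\<in>?H 0 2. complexify v = x + y"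
    then obtain x y where "x \<in> ?H 2 0" "y \<in> ?H 0 2" "complexify v = x + y" by blast
    with v(1) show "bform G v v > 0" by (rule posdef)
  qed
qed

section \<open>The locus and eigenspaces of rational maps\<close>

text \<open>Self-adjointness and \<open>\<psi>\<^sup>2 = m\<close> give the multiplier. The
  eigenvector and its conjugate span invariant lines, and a self-adjoint map preserves the
  orthogonal complement of its eigenvectors.\<close>

lemma line_in_similarity_locusI:
  fixes \<omega> :: "complex ^ 'n"
  assumes sym: "\<And>i j. G $ i $ j = G $ j $ i"
    and \<omega>: "\<omega> \<noteq> 0" "line \<omega> \<in> period_domain G"
    and lin: "Vector_Spaces.linear (*s) (*s) \<psi>"
    and square: "\<And>v. \<psi> (\<psi> v) = m *s v" and "m \<noteq> 0"
    and adj: "rosati_fixed G \<psi>"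
    and eigen: "complexify_map \<psi> \<omega> = \<mu> *s \<omega>"
  shows "line \<omega> \<in> similarity_locus G m"
proof -
  let ?\<Psi> = "complexify_map \<psi>" and ?H = "hodge_of G \<omega>"
  have iso: "bform G \<omega> \<omega> = 0" and pos: "Re (bform G \<omega> (vcnj \<omega>)) > 0"
    using \<omega> line_in_period_domain_iff by blast+
  have adjC: "bform G (?\<Psi> x) y = bform G x (?\<Psi> y)" for x y
    using complexify_bform_identity[OF lin vec.linear_id[unfolded id_def] vec.linear_id[unfolded id_def] lin, of G 1 x y]
      adj by (simp add: rosati_fixed_def complexify_map_id)
  have square_C: "?\<Psi> (?\<Psi> x) = of_rat m *s x" for x
    by (rule complex_linear_eqI[where f = "\<lambda>x. ?\<Psi> (?\<Psi> x)" and g = "\<lambda>x. of_rat m *s x"])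
      (simp_all add: complexify_map_add complexify_map_scale complexify_map_rat_vec lin square
        vec.scale_right_distrib mult.commute, simp add: rat_vec_def vec_eq_iff of_rat_mult)
  have \<mu>: "\<mu> \<noteq> 0"
  proof
    assume "\<mu> = 0"
    then have "?\<Psi> (?\<Psi> \<omega>) = 0" using eigen complexify_map_scale[of \<psi> 0] by simp
    then show False using square_C[of \<omega>] \<omega>(1) \<open>m \<noteq> 0\<close> by simp
  qed
  have eigen': "?\<Psi> (vcnj \<omega>) = cnj \<mu> *s vcnj \<omega>"
    by (simp add: complexify_map_vcnj eigen vcnj_scale)
  have img_line: "?\<Psi> ` line v = line v" if "?\<Psi> v = c *s v" "c \<noteq> 0" for v c
  proof -
    have "range (\<lambda>a. (a * c) *s v) = range (\<lambda>a. a *s v)"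
    proof (intro equalityI subsetI)
      fix y assume "y \<in> range (\<lambda>a. a *s v)"
      then obtain a where "y = a *s v" by blast
      then have "y = ((a / c) * c) *s v" using that by simp
      then show "y \<in> range (\<lambda>a. (a * c) *s v)" by blast
    qed auto
    then show ?thesis using that by (simp add: line_eq full_SetCompr_eq image_image complexify_map_scale)
  qed
  have img_orth: "?\<Psi> ` {x. bform G x \<omega> = 0 \<and> bform G x (vcnj \<omega>) = 0} =
      {x. bform G x \<omega> = 0 \<and> bform G x (vcnj \<omega>) = 0}" (is "_ ` ?K = _")
  proof
    have *: "?\<Psi> x \<in> ?K" if "x \<in> ?K" for x
    proof -
      have "bform G (?\<Psi> x) \<omega> = \<mu> * bform G x \<omega>"
        using adjC[of x \<omega>] by (simp only: eigen bform_scale_right)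
      moreover have "bform G (?\<Psi> x) (vcnj \<omega>) = cnj \<mu> * bform G x (vcnj \<omega>)"
        using adjC[of x "vcnj \<omega>"] by (simp only: eigen' bform_scale_right)
      ultimately show ?thesis using that by simp
    qed
    then show "?\<Psi> ` ?K \<subseteq> ?K" by blast
    show "?K \<subseteq> ?\<Psi> ` ?K"
    proof
      fix x assume x: "x \<in> ?K"
      have "x = ?\<Psi> ((1 / of_rat m) *s ?\<Psi> x)"
        using \<open>m \<noteq> 0\<close> by (simp add: complexify_map_scale square_C)
      moreover have "(1 / of_rat m) *s ?\<Psi> x \<in> ?K"
        using *[OF x] by (simp add: bform_scale_left)
      ultimately show "x \<in> ?\<Psi> ` ?K" by blast
    qed
  qed
  have "?\<Psi> ` ?H a b = ?H a b" for a b
    using img_line[OF eigen \<mu>] img_line[OF eigen'] \<mu> img_orth complexify_map_scale[of \<psi> 0]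
    by (auto simp: hodge_of_def)
  moreover have "bij \<psi>"
  proof (rule o_bij)
    have sc: "\<psi> (c *s v) = c *s \<psi> v" for c v
      using lin by (simp add: Vector_Spaces.linear_iff)
    show "(\<lambda>v. (1 / m) *s \<psi> v) \<circ> \<psi> = id" "\<psi> \<circ> (\<lambda>v. (1 / m) *s \<psi> v) = id"
      using \<open>m \<noteq> 0\<close> by (auto simp: square sc)
  qed
  moreover have "bform G (\<psi> v) (\<psi> w) = m * bform G v w" for v w
    using adj by (simp add: rosati_fixed_def square bform_scale_right)
  ultimately have "hodge_similarity G ?H m \<psi>"
    using lin by (simp add: hodge_similarity_def hodge_automorphism_def)
  moreover have "?H 2 0 = line \<omega>" by (simp add: hodge_of_def)
  ultimately show ?thesis
    using K3_type_hodge_of[OF sym iso pos] adj \<omega>(2) unfolding similarity_locus_def by blast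
qed

text \<open>Pairing \<open>\<omega>\<close> with \<open>vcnj \<omega>\<close> turns the multiplier
  into \<open>cnj \<mu> * \<mu> = m\<close> and self-adjointness into
  \<open>\<mu> = cnj \<mu>\<close>. The map is handed over as a rational matrix because those form a
  countable type.\<close>

lemma similarity_locus_eigenline:
  fixes \<omega> :: "complex ^ 'n"
  assumes "line \<omega> \<in> similarity_locus G m" "\<omega> \<noteq> 0"
  obtains A :: "rat ^ 'n ^ 'n" and \<mu> where
    "(\<chi> i j. of_rat (A $ i $ j)) *v \<omega> = \<mu> *s \<omega>" "\<mu>\<^sup>2 = of_rat m"
proof -
  obtain H \<psi> where H: "H 2 0 = line \<omega>" and sim: "hodge_similarity G H m \<psi>" and ros: "rosati_fixed G \<psi>"
    and per: "line \<omega> \<in> period_domain G"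
    using assms(1) unfolding similarity_locus_def by blast
  let ?\<Psi> = "complexify_map \<psi>"
  have lin: "Vector_Spaces.linear (*s) (*s) \<psi>" and img: "?\<Psi> ` line \<omega> = line \<omega>"
    using sim unfolding hodge_similarity_def hodge_automorphism_def H[symmetric] by blast+
  have "?\<Psi> \<omega> \<in> line \<omega>" using img mem_line by blast
  then obtain \<mu> where \<mu>: "?\<Psi> \<omega> = \<mu> *s \<omega>" by (auto simp: line_eq)
  have \<mu>': "?\<Psi> (vcnj \<omega>) = cnj \<mu> *s vcnj \<omega>" by (simp add: complexify_map_vcnj \<mu> vcnj_scale)
  define n where "n = bform G \<omega> (vcnj \<omega>)"
  have "n \<noteq> 0" using per assms(2) by (auto simp: line_in_period_domain_iff n_def)
  note id = vec.linear_id[unfolded id_def]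
  have "bform G (?\<Psi> x) (?\<Psi> y) = of_rat m * bform G x y" for x y
    using complexify_bform_identity[OF lin lin id id, of G m x y] sim
    by (simp add: hodge_similarity_def complexify_map_id)
  from this[of \<omega> "vcnj \<omega>"] have "cnj \<mu> * \<mu> = of_rat m"
    using \<open>n \<noteq> 0\<close> by (simp add: \<mu> \<mu>' bform_scale_left bform_scale_right flip: n_def)
  moreover have "bform G (?\<Psi> x) y = bform G x (?\<Psi> y)" for x y
    using complexify_bform_identity[OF lin id id lin, of G 1 x y] ros
    by (simp add: rosati_fixed_def complexify_map_id)
  from this[of \<omega> "vcnj \<omega>"] have "\<mu> = cnj \<mu>"
    using \<open>n \<noteq> 0\<close> by (simp add: \<mu> \<mu>' bform_scale_left bform_scale_right flip: n_def)
  ultimately have "\<mu>\<^sup>2 = of_rat m" by (simp add: power2_eq_square)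
  then show ?thesis using that[of "matrix \<psi>" \<mu>] \<mu> by (simp add: complexify_map_def)
qed

section \<open>Orthogonal coordinates on the \<open>E\<^sub>8\<close> lattice\<close>

lemma exhaust_8:
  fixes x :: 8
  shows "x = 1 \<or> x = 2 \<or> x = 3 \<or> x = 4 \<or> x = 5 \<or> x = 6 \<or> x = 7 \<or> x = 8"
proof (induct x)
  case (of_int z)
  \<comment> \<open>The residue 0 is the numeral 8 of this type.\<close>
  then have "z = 0 \<or> z = 1 \<or> z = 2 \<or> z = 3 \<or> z = 4 \<or> z = 5 \<or> z = 6 \<or> z = 7" by simp arith
  then show ?case by auto
qed

lemma UNIV_8: "(UNIV :: 8 set) = {1, 2, 3, 4, 5, 6, 7, 8}"
  using exhaust_8 by auto

lemma sum_8: "sum f (UNIV :: 8 set) = f 1 + f 2 + f 3 + f 4 + f 5 + f 6 + f 7 + f 8"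
  unfolding UNIV_8 by (simp add: ac_simps)

lemma forall_8: "(\<forall>i::8. P i) \<longleftrightarrow> P 1 \<and> P 2 \<and> P 3 \<and> P 4 \<and> P 5 \<and> P 6 \<and> P 7 \<and> P 8"
  by (metis exhaust_8)

definition vec8 :: "'a \<Rightarrow> 'a \<Rightarrow> 'a \<Rightarrow> 'a \<Rightarrow> 'a \<Rightarrow> 'a \<Rightarrow> 'a \<Rightarrow> 'a \<Rightarrow> 'a ^ 8" where
  "vec8 a b c d e f g h = (\<chi> i. if i = 1 then a else if i = 2 then b else if i = 3 then c
     else if i = 4 then d else if i = 5 then e else if i = 6 then f else if i = 7 then g else h)"

lemma vec8_nth [simp]:
  "vec8 a b c d e f g h $ 1 = a" "vec8 a b c d e f g h $ 2 = b"
  "vec8 a b c d e f g h $ 3 = c" "vec8 a b c d e f g h $ 4 = d"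
  "vec8 a b c d e f g h $ 5 = e" "vec8 a b c d e f g h $ 6 = f"
  "vec8 a b c d e f g h $ 7 = g" "vec8 a b c d e f g h $ 8 = h"
  by (simp_all add: vec8_def)

text \<open>
  The simple roots in Bourbaki's realization are \<open>(\<epsilon>\<^sub>1 + \<epsilon>\<^sub>8 - \<epsilon>\<^sub>2 - \<dots> - \<epsilon>\<^sub>7)/2\<close>, \<open>\<epsilon>\<^sub>1 + \<epsilon>\<^sub>2\<close> and
  \<open>\<epsilon>\<^sub>k - \<epsilon>\<^sub>k\<^sub>-\<^sub>1\<close> for \<open>k = 2, \<dots>, 7\<close>; \<open>e8_coords\<close> turns coefficients with respect to them into
  coordinates with respect to the orthonormal basis \<open>\<epsilon>\<^sub>1, \<dots>, \<epsilon>\<^sub>8\<close>.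
\<close>

definition e8_coords :: "'a::field_char_0 ^ 8 \<Rightarrow> 'a ^ 8" where
  "e8_coords x = vec8 (x $ 1 / 2 + x $ 2 - x $ 3) (x $ 2 + x $ 3 - x $ 4 - x $ 1 / 2)
     (x $ 4 - x $ 5 - x $ 1 / 2) (x $ 5 - x $ 6 - x $ 1 / 2) (x $ 6 - x $ 7 - x $ 1 / 2)
     (x $ 7 - x $ 8 - x $ 1 / 2) (x $ 8 - x $ 1 / 2) (x $ 1 / 2)"

definition e8_of_coords :: "'a::field_char_0 ^ 8 \<Rightarrow> 'a ^ 8" where
  "e8_of_coords z = vec8 (2 * z $ 8)
     ((z $ 1 + z $ 2 + z $ 3 + z $ 4 + z $ 5 + z $ 6 + z $ 7 + 5 * z $ 8) / 2)
     ((z $ 2 - z $ 1 + z $ 3 + z $ 4 + z $ 5 + z $ 6 + z $ 7 + 7 * z $ 8) / 2)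
     (z $ 3 + z $ 4 + z $ 5 + z $ 6 + z $ 7 + 5 * z $ 8)
     (z $ 4 + z $ 5 + z $ 6 + z $ 7 + 4 * z $ 8)
     (z $ 5 + z $ 6 + z $ 7 + 3 * z $ 8) (z $ 6 + z $ 7 + 2 * z $ 8) (z $ 7 + z $ 8)"

lemma e8_coords_of_coords [simp]: "e8_coords (e8_of_coords z) = z"
  by (simp add: e8_coords_def e8_of_coords_def vec_eq_iff forall_8 field_simps)

lemma e8_of_coords_coords [simp]: "e8_of_coords (e8_coords x) = x"
  by (simp add: e8_coords_def e8_of_coords_def vec_eq_iff forall_8 field_simps)

text \<open>In these coordinates the form is a sum of eight squares, which lets the similarity be
  written down in blocks of size two.\<close>

lemma bform_E8:
  "bform E8_lattice x y = (\<Sum>i\<in>UNIV. e8_coords x $ i * e8_coords (y :: 'a::field_char_0 ^ 8) $ i)"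
  unfolding bform_def E8_lattice_def E8_edges_def
  by (simp add: sum_8 e8_coords_def) (simp add: field_simps)

section \<open>The similarity of \<open>\<Lambda>\<close>\<close>

definition mk_lam :: "'a::field_char_0 \<Rightarrow> 'a \<Rightarrow> 'a \<Rightarrow> 'a \<Rightarrow> 'a ^ 8 \<Rightarrow> 'a ^ lam" where
  "mk_lam a b c d z = (\<chi> i. case i of
      Inl (Inl k) \<Rightarrow> if k = 1 then a else b
    | Inl (Inr k) \<Rightarrow> if k = 1 then c else d
    | Inr k \<Rightarrow> e8_of_coords z $ k)"

definition lam_coords :: "'a::field_char_0 ^ lam \<Rightarrow> 'a ^ 8" where
  "lam_coords x = e8_coords (\<chi> k. x $ Inr k)"

abbreviation (input) U1 :: "'a ^ lam \<Rightarrow> 'a" where "U1 x \<equiv> x $ Inl (Inl 1)"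
abbreviation (input) U2 :: "'a ^ lam \<Rightarrow> 'a" where "U2 x \<equiv> x $ Inl (Inl 2)"
abbreviation (input) U3 :: "'a ^ lam \<Rightarrow> 'a" where "U3 x \<equiv> x $ Inl (Inr 1)"
abbreviation (input) U4 :: "'a ^ lam \<Rightarrow> 'a" where "U4 x \<equiv> x $ Inl (Inr 2)"

lemma mk_lam_nth [simp]:
  "U1 (mk_lam a b c d z) = a" "U2 (mk_lam a b c d z) = b"
  "U3 (mk_lam a b c d z) = c" "U4 (mk_lam a b c d z) = d"
  "lam_coords (mk_lam a b c d z) = z"
  by (simp_all add: mk_lam_def lam_coords_def)

lemma mk_lam_eta: "mk_lam (U1 x) (U2 x) (U3 x) (U4 x) (lam_coords x) = x"
proof -
  have "mk_lam (U1 x) (U2 x) (U3 x) (U4 x) (lam_coords x) $ i = x $ i" for i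
  proof (cases i)
    case (Inl j)
    then show ?thesis
      by (cases j) (use exhaust_2 in \<open>auto simp: mk_lam_def\<close>)
  next
    case (Inr k)
    then show ?thesis by (simp add: mk_lam_def lam_coords_def)
  qed
  then show ?thesis by (simp add: vec_eq_iff)
qed

lemma lam_eqI:
  assumes "U1 x = U1 y" "U2 x = U2 y" "U3 x = U3 y" "U4 x = U4 y" "lam_coords x = lam_coords y"
  shows "x = y"
  using assms by (metis mk_lam_eta)

lemma lam_coords_add: "lam_coords (x + y) = lam_coords x + lam_coords y"
  and lam_coords_scale: "lam_coords (c *s x) = c *s lam_coords x"
  by (simp_all add: lam_coords_def e8_coords_def vec_eq_iff forall_8 field_simps)

lemma sum_UNIV_sum_type:
  "sum f (UNIV :: ('a::finite + 'b::finite) set) = (\<Sum>k\<in>UNIV. f (Inl k)) + (\<Sum>k\<in>UNIV. f (Inr k))"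
  unfolding UNIV_Plus_UNIV[symmetric] by (subst sum.Plus) auto

lemma sum_lam:
  "sum f (UNIV :: lam set) = f (Inl (Inl 1)) + f (Inl (Inl 2)) + f (Inl (Inr 1)) + f (Inl (Inr 2))
     + (\<Sum>k\<in>UNIV. f (Inr k))"
  by (simp add: sum_UNIV_sum_type sum_2 add.assoc)

lemma Lam_sym: "Lam $ i $ j = Lam $ j $ i"
proof -
  have "U_lattice $ a $ b = U_lattice $ b $ a" for a b
    by (simp add: U_lattice_def)
  moreover have "E8_lattice $ a $ b = E8_lattice $ b $ a" for a b
    by (auto simp: E8_lattice_def)
  ultimately show ?thesis
    by (cases i; cases j) (auto simp: Lam_def orth_sum_def rescale_def split: sum.splits)
qed

lemma bform_Lam:
  fixes x y :: "'a::field_char_0 ^ lam"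
  shows "bform Lam x y = U1 x * U2 y + U2 x * U1 y + U3 x * U4 y + U4 x * U3 y
    - 2 * (\<Sum>i\<in>UNIV. lam_coords x $ i * lam_coords y $ i)"
proof -
  have "bform Lam x y = U1 x * U2 y + U2 x * U1 y + U3 x * U4 y + U4 x * U3 y
      - 2 * bform E8_lattice (\<chi> k. x $ Inr k) (\<chi> k. y $ Inr k)"
    unfolding bform_def
    by (simp add: sum_lam Lam_def orth_sum_def rescale_def U_lattice_def sum_distrib_left
        sum_negf[symmetric] mult.assoc)
  then show ?thesis by (simp add: bform_E8 lam_coords_def)
qed

text \<open>
  Multiplication by \<open>\<surd>2\<close> on \<open>\<rat>(\<surd>2)\<close>: the form \<open>(x, y) \<mapsto> Tr(xy/\<surd>2)/2\<close> makes each hyperbolic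
  plane a rank-one space over \<open>\<rat>(\<surd>2)\<close>, and on orthonormal pairs of \<open>E\<^sub>8\<close> the symmetric
  matrix \<open>((1, 1), (1, -1))\<close> squares to 2.
\<close>

definition pair_sim :: "'a::field_char_0 ^ 8 \<Rightarrow> 'a ^ 8" where
  "pair_sim z = vec8 (z $ 1 + z $ 2) (z $ 1 - z $ 2) (z $ 3 + z $ 4) (z $ 3 - z $ 4)
     (z $ 5 + z $ 6) (z $ 5 - z $ 6) (z $ 7 + z $ 8) (z $ 7 - z $ 8)"

text \<open>If \<open>(a, b)\<close> stands for a + b sqrt 2, multiplication by sqrt 2 sends it to
  \<open>(2 * b, a)\<close>. Over a general field the one formula serves both as the rational
  similarity and as its complexification.\<close>

definition lam_sim :: "'a::field_char_0 ^ lam \<Rightarrow> 'a ^ lam" where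
  "lam_sim x = mk_lam (2 * U2 x) (U1 x) (2 * U4 x) (U3 x) (pair_sim (lam_coords x))"

lemma lam_sim_add: "lam_sim (x + y) = lam_sim x + lam_sim y"
  by (rule lam_eqI)
    (simp_all add: lam_sim_def lam_coords_add pair_sim_def vec_eq_iff forall_8 algebra_simps)

lemma lam_sim_scale: "lam_sim (c *s x) = c *s lam_sim x"
  by (rule lam_eqI)
    (simp_all add: lam_sim_def lam_coords_scale pair_sim_def vec_eq_iff forall_8 algebra_simps)

lemma linear_lam_sim: "Vector_Spaces.linear (*s) (*s) lam_sim"
  using vec.vector_space_axioms by (simp add: Vector_Spaces.linear_iff lam_sim_add lam_sim_scale)

lemma lam_sim_lam_sim: "lam_sim (lam_sim x) = 2 *s x"
  by (rule lam_eqI)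
    (simp_all add: lam_sim_def lam_coords_scale pair_sim_def vec_eq_iff forall_8)

lemma lam_sim_self_adjoint: "bform Lam (lam_sim x) y = bform Lam x (lam_sim y)"
  by (simp add: bform_Lam lam_sim_def pair_sim_def sum_8 algebra_simps)

lemma CARD_lam: "CARD(lam) = 12"
  by simp

section \<open>Holomorphic functions on projective space\<close>

lemma holomorphic_severalE:
  assumes "holomorphic_several f S" "x \<in> S"
  obtains D where "functional D" "(f has_derivative D) (at x)"
  using assms unfolding holomorphic_several_def by blast

lemma holomorphic_several_functional:
  assumes "functional L" "open S"
  shows "holomorphic_several L S"
  using assms bounded_linear_imp_has_derivative[OF bounded_linear_functional]
  by (auto simp: holomorphic_several_def)

lemma holomorphic_several_const:
  assumes "open S"
  shows "holomorphic_several (\<lambda>x. c) S"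
  using assms
  by (auto simp: holomorphic_several_def functional_iff intro!: exI[of _ "\<lambda>x. 0"])

lemma holomorphic_several_diff:
  assumes "holomorphic_several f S" "holomorphic_several g S"
  shows "holomorphic_several (\<lambda>x. f x - g x) S"
  unfolding holomorphic_several_def
proof (intro conjI ballI)
  show "open S" using assms by (simp add: holomorphic_several_def)
  fix x assume x: "x \<in> S"
  obtain D E where "functional D" "(f has_derivative D) (at x)" "functional E" "(g has_derivative E) (at x)"
    using assms x by (meson holomorphic_severalE)
  then show "\<exists>D. functional D \<and> ((\<lambda>x. f x - g x) has_derivative D) (at x)"
    by (intro exI[of _ "\<lambda>h. D h - E h"] conjI has_derivative_diff)
      (auto simp: functional_iff algebra_simps)
qed

lemma holomorphic_several_mult:
  assumes "holomorphic_several f S" "holomorphic_several g S"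
  shows "holomorphic_several (\<lambda>x. f x * g x) S"
  unfolding holomorphic_several_def
proof (intro conjI ballI)
  show "open S" using assms by (simp add: holomorphic_several_def)
  fix x assume x: "x \<in> S"
  obtain D E where "functional D" "(f has_derivative D) (at x)" "functional E" "(g has_derivative E) (at x)"
    using assms x by (meson holomorphic_severalE)
  then show "\<exists>D. functional D \<and> ((\<lambda>x. f x * g x) has_derivative D) (at x)"
    by (intro exI[of _ "\<lambda>h. f x * E h + D h * g x"] conjI has_derivative_mult)
      (auto simp: functional_iff algebra_simps)
qed

lemma holomorphic_several_inverse:
  assumes "holomorphic_several f S" "\<And>x. x \<in> S \<Longrightarrow> f x \<noteq> 0"
  shows "holomorphic_several (\<lambda>x. inverse (f x)) S"
  unfolding holomorphic_several_def
proof (intro conjI ballI)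
  show "open S" using assms by (simp add: holomorphic_several_def)
  fix x assume x: "x \<in> S"
  obtain D where D: "functional D" "(f has_derivative D) (at x)"
    using assms(1) x by (meson holomorphic_severalE)
  then have "functional (\<lambda>h. - (inverse (f x) * D h * inverse (f x)))"
    by (auto simp: functional_iff algebra_simps)
  moreover have "((\<lambda>x. inverse (f x)) has_derivative (\<lambda>h. - (inverse (f x) * D h * inverse (f x)))) (at x)"
    using Deriv.has_derivative_inverse[OF assms(2)[OF x] D(2)] by simp
  ultimately show "\<exists>D. functional D \<and> ((\<lambda>x. inverse (f x)) has_derivative D) (at x)"
    by blast
qed

lemma holomorphic_several_divide:
  assumes "holomorphic_several f S" "holomorphic_several g S" "\<And>x. x \<in> S \<Longrightarrow> g x \<noteq> 0"
  shows "holomorphic_several (\<lambda>x. f x / g x) S"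
  unfolding divide_inverse using assms
  by (intro holomorphic_several_mult holomorphic_several_inverse)

lemma holomorphic_several_cong:
  assumes "holomorphic_several f S" "\<And>x. x \<in> S \<Longrightarrow> f x = g x"
  shows "holomorphic_several g S"
  unfolding holomorphic_several_def
proof (intro conjI ballI)
  show S: "open S" using assms by (simp add: holomorphic_several_def)
  fix x assume x: "x \<in> S"
  obtain D where D: "functional D" "(f has_derivative D) (at x)"
    using assms(1) x by (meson holomorphic_severalE)
  have "(g has_derivative D) (at x)"
    using has_derivative_transform_within_open[OF D(2) S x assms(2)] by simp
  then show "\<exists>D. functional D \<and> (g has_derivative D) (at x)" using D(1) by blast
qed

text \<open>A quotient of homogeneous functions of equal degree, evaluated on a line via any spanning vector.\<close>

definition hquot :: "(complex ^ 'n \<Rightarrow> complex) \<Rightarrow> (complex ^ 'n \<Rightarrow> complex) \<Rightarrow> (complex ^ 'n) set \<Rightarrow> complex" where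
  "hquot g h l = (let y = (SOME y. y \<in> l \<and> y \<noteq> 0) in g y / h y)"

definition homogeneous :: "nat \<Rightarrow> (complex ^ 'n \<Rightarrow> complex) \<Rightarrow> bool" where
  "homogeneous d g \<longleftrightarrow> (\<forall>c x. g (c *s x) = c ^ d * g x)"

lemma hquot_line:
  assumes "homogeneous d g" "homogeneous d h" "v \<noteq> 0"
  shows "hquot g h (line v) = g v / h v"
proof -
  define y where "y = (SOME y. y \<in> line v \<and> y \<noteq> 0)"
  have "y \<in> line v \<and> y \<noteq> 0"
    unfolding y_def by (rule someI[of _ v]) (use assms in simp)
  then obtain c where "y = c *s v" "c \<noteq> 0" by (auto simp: line_eq)
  then have "g y / h y = g v / h v" using assms by (simp add: homogeneous_def)
  then show ?thesis by (simp add: hquot_def y_def)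
qed

lemma proj_holomorphic_hquot:
  assumes "homogeneous d g" "homogeneous d h"
    and "openin proj_topology N"
    and "holomorphic_several g (affine_cone N)" "holomorphic_several h (affine_cone N)"
    and "\<And>x. x \<in> affine_cone N \<Longrightarrow> h x \<noteq> 0"
  shows "proj_holomorphic (hquot g h) N"
  unfolding proj_holomorphic_def
proof
  show "holomorphic_several (\<lambda>v. hquot g h (line v)) (affine_cone N)"
    by (rule holomorphic_several_cong[OF holomorphic_several_divide[OF assms(4-6)]])
      (auto simp: affine_cone_iff hquot_line[OF assms(1,2)])
qed fact

lemma proj_holomorphic_const:
  assumes "openin proj_topology N"
  shows "proj_holomorphic (\<lambda>l. c) N"
  using assms by (simp add: proj_holomorphic_def openin_proj_topology holomorphic_several_const)

text \<open>As \<open>g v = 0\<close>, the derivative of \<open>h\<close> drops out of the quotient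
  rule.\<close>

lemma has_derivative_hquot:
  assumes "homogeneous d g" "homogeneous d h" "v \<noteq> 0"
    and "(g has_derivative D) (at v)" "(h has_derivative E) (at v)" "g v = 0" "h v \<noteq> 0"
  shows "((\<lambda>x. hquot g h (line x)) has_derivative (\<lambda>x. D x / h v)) (at v)"
proof (rule has_derivative_transform_within_open)
  show "((\<lambda>x. g x / h x) has_derivative (\<lambda>x. D x / h v)) (at v)"
    using has_derivative_divide[OF assms(4,5,7)] unfolding assms(6)
    by (simp add: divide_inverse)
  show "open (- {0 :: complex ^ 'a})" by (simp add: open_Compl)
  show "v \<in> - {0}" using assms(3) by simp
  show "g x / h x = hquot g h (line x)" if "x \<in> - {0}" for x
    using hquot_line[OF assms(1,2), of x] that by simp
qed

section \<open>The eigenspace\<close>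

definition rt2 :: complex where "rt2 = of_real (sqrt 2)"

lemma rt2_sq [simp]: "rt2 * rt2 = 2" "rt2 * (rt2 * x) = 2 * x"
proof -
  show 1: "rt2 * rt2 = 2"
    by (simp add: rt2_def flip: of_real_mult)
  then show "rt2 * (rt2 * x) = 2 * x" by (simp flip: mult.assoc)
qed

lemma cnj_rt2 [simp]: "cnj rt2 = rt2"
  by (simp add: rt2_def)

text \<open>
  \<open>scl\<close> is chosen so that \<open>(1 + \<surd>2)\<^sup>2 + 1 = \<surd>2 \<cdot> scl\<^sup>2\<close>: the form becomes \<open>2\<surd>2 (\<alpha>\<beta> - \<Sum> w\<^sub>k\<^sup>2)\<close> on
  the eigenspace.
\<close>

definition scl :: complex where "scl = of_real (sqrt (2 + 2 * sqrt 2))"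

lemma scl_facts: "scl * scl = 2 + 2 * rt2" "cnj scl = scl" "scl \<noteq> 0"
proof -
  have p: "2 + 2 * sqrt 2 > 0" by (simp add: add_pos_pos)
  then have "sqrt (2 + 2 * sqrt 2) * sqrt (2 + 2 * sqrt 2) = 2 + 2 * sqrt 2" by simp
  then have "of_real (sqrt (2 + 2 * sqrt 2) * sqrt (2 + 2 * sqrt 2)) = (of_real (2 + 2 * sqrt 2) :: complex)"
    by (rule arg_cong)
  then show "scl * scl = 2 + 2 * rt2"
    by (simp only: scl_def rt2_def of_real_mult of_real_add of_real_numeral)
  show "cnj scl = scl" by (simp add: scl_def)
  show "scl \<noteq> 0" using p by (simp add: scl_def)
qed

text \<open>Isotropic coordinates for the positive part of the form on the eigenspace: s^2 + t^2
  factors as (s + i t)(s - i t).\<close>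

definition alp :: "complex ^ lam \<Rightarrow> complex" where "alp x = U2 x + \<i> * U4 x"
definition bet :: "complex ^ lam \<Rightarrow> complex" where "bet x = U2 x - \<i> * U4 x"
definition wc :: "complex ^ lam \<Rightarrow> complex ^ 4" where
  "wc x = scl *s vector [lam_coords x $ 2, lam_coords x $ 4, lam_coords x $ 6, lam_coords x $ 8]"

text \<open>Equations of the sqrt 2-eigenspace: the blocks of \<open>lam_sim\<close> have
  eigenvectors \<open>(rt2, 1)\<close> and \<open>(1 + rt2, 1)\<close>. Each equation contains a
  coordinate absent from all the others.\<close>

definition normal_form :: "nat \<Rightarrow> complex ^ lam \<Rightarrow> complex" where
  "normal_form i x =
    (if i = 0 then U1 x - rt2 * U2 x
     else if i = 1 then U3 x - rt2 * U4 x
     else if i = 2 then lam_coords x $ 1 - (1 + rt2) * lam_coords x $ 2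
     else if i = 3 then lam_coords x $ 3 - (1 + rt2) * lam_coords x $ 4
     else if i = 4 then lam_coords x $ 5 - (1 + rt2) * lam_coords x $ 6
     else lam_coords x $ 7 - (1 + rt2) * lam_coords x $ 8)"

text \<open>Inverse of the coordinates \<open>alp\<close>, \<open>bet\<close>, \<open>wc\<close> on
  the eigenspace.\<close>

definition vplus :: "complex \<Rightarrow> complex \<Rightarrow> complex ^ 4 \<Rightarrow> complex ^ lam" where
  "vplus a b w = (let s = (a + b) / 2; t = (a - b) / (2 * \<i>); u = (\<lambda>k. w $ k / scl) in
     mk_lam (rt2 * s) s (rt2 * t) t
       (vec8 ((1 + rt2) * u 1) (u 1) ((1 + rt2) * u 2) (u 2) ((1 + rt2) * u 3) (u 3) ((1 + rt2) * u 4) (u 4)))"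

definition dot4 :: "complex ^ 4 \<Rightarrow> complex ^ 4 \<Rightarrow> complex" where
  "dot4 v w = (\<Sum>k\<in>UNIV. v $ k * w $ k)"

lemma vector_4_nth [simp]:
  "(vector [a, b, c, d] :: 'a::zero ^ 4) $ 1 = a" "(vector [a, b, c, d] :: 'a ^ 4) $ 2 = b"
  "(vector [a, b, c, d] :: 'a ^ 4) $ 3 = c" "(vector [a, b, c, d] :: 'a ^ 4) $ 4 = d"
  by (simp_all add: vector_def)

lemma functional_coords:
  "functional alp" "functional bet" "functional (\<lambda>x. wc x $ k)" "functional (normal_form i)"
  "functional (\<lambda>x. dot4 w (wc x))"
proof -
  have w: "wc (x + y) = wc x + wc y" "wc (c *s x) = c *s wc x" for x y c
    by (simp_all add: wc_def lam_coords_add lam_coords_scale vec_eq_iff forall_4 algebra_simps)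
  then show "functional (\<lambda>x. wc x $ k)" "functional (\<lambda>x. dot4 w (wc x))"
    by (simp_all add: functional_iff dot4_def sum.distrib sum_distrib_left algebra_simps)
  show "functional alp" "functional bet" "functional (normal_form i)"
    by (simp_all add: functional_iff alp_def bet_def normal_form_def lam_coords_add lam_coords_scale algebra_simps)
qed

lemma coords_vplus [simp]:
  "alp (vplus a b w) = a" "bet (vplus a b w) = b" "wc (vplus a b w) = w" "normal_form i (vplus a b w) = 0"
  by (simp_all add: vplus_def alp_def bet_def wc_def normal_form_def Let_def scl_facts field_simps
      vec_eq_iff forall_4)

lemma normal_form_iff:
  "(\<forall>i<6. normal_form i x = 0) \<longleftrightarrow> U1 x = rt2 * U2 x \<and> U3 x = rt2 * U4 x \<and>
     lam_coords x $ 1 = (1 + rt2) * lam_coords x $ 2 \<and> lam_coords x $ 3 = (1 + rt2) * lam_coords x $ 4 \<and>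
     lam_coords x $ 5 = (1 + rt2) * lam_coords x $ 6 \<and> lam_coords x $ 7 = (1 + rt2) * lam_coords x $ 8"
proof -
  have "(\<forall>i<6. P i) \<longleftrightarrow> P 0 \<and> P 1 \<and> P 2 \<and> P 3 \<and> P 4 \<and> P (5::nat)" for P
    by (simp add: numeral_eq_Suc All_less_Suc) blast
  then show ?thesis by (simp add: normal_form_def)
qed

lemma eigen_iff_normal_form: "lam_sim x = rt2 *s x \<longleftrightarrow> (\<forall>i<6. normal_form i x = 0)"
proof
  assume eq: "lam_sim x = rt2 *s x"
  have "lam_coords (lam_sim x) = rt2 *s lam_coords x"
    by (simp only: eq lam_coords_scale)
  then have "pair_sim (lam_coords x) $ k = rt2 * lam_coords x $ k" for k
    by (simp add: lam_sim_def)
  from this[of 2] this[of 4] this[of 6] this[of 8]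
  have "lam_coords x $ 1 = (1 + rt2) * lam_coords x $ 2" "lam_coords x $ 3 = (1 + rt2) * lam_coords x $ 4"
    "lam_coords x $ 5 = (1 + rt2) * lam_coords x $ 6" "lam_coords x $ 7 = (1 + rt2) * lam_coords x $ 8"
    by (simp_all add: pair_sim_def algebra_simps)
  moreover have "U2 (lam_sim x) = rt2 * U2 x" "U4 (lam_sim x) = rt2 * U4 x"
    by (simp_all only: eq vector_smult_component)
  ultimately show "\<forall>i<6. normal_form i x = 0"
    by (simp add: normal_form_iff lam_sim_def)
next
  assume "\<forall>i<6. normal_form i x = 0"
  then show "lam_sim x = rt2 *s x"
    unfolding normal_form_iff
    by (intro lam_eqI) (simp_all add: lam_sim_def lam_coords_scale pair_sim_def vec_eq_iff forall_8 algebra_simps)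
qed

lemma vplus_coords:
  assumes "\<forall>i<6. normal_form i x = 0"
  shows "vplus (alp x) (bet x) (wc x) = x"
  using assms unfolding normal_form_iff
  by (intro lam_eqI) (simp_all add: vplus_def Let_def alp_def bet_def wc_def scl_facts vec_eq_iff forall_8)

lemma dot4_wc: "dot4 (wc x) (wc y) = (2 + 2 * rt2) *
  (lam_coords x $ 2 * lam_coords y $ 2 + lam_coords x $ 4 * lam_coords y $ 4 +
   lam_coords x $ 6 * lam_coords y $ 6 + lam_coords x $ 8 * lam_coords y $ 8)"
  unfolding scl_facts(1)[symmetric] dot4_def wc_def by (simp add: sum_4 algebra_simps)

lemma vcnj_coords:
  "lam_coords (vcnj x) $ k = cnj (lam_coords x $ k)"
  "wc (vcnj x) = vcnj (wc x)"
proof -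
  have "\<forall>k. lam_coords (vcnj x) $ k = cnj (lam_coords x $ k)"
    by (simp add: forall_8 lam_coords_def e8_coords_def vcnj_def)
  then show "lam_coords (vcnj x) $ k = cnj (lam_coords x $ k)" for k by blast
  then show "wc (vcnj x) = vcnj (wc x)"
    by (simp add: wc_def vcnj_def vec_eq_iff forall_4 scl_facts)
qed

lemma dot4_vcnj: "dot4 w (vcnj w) = of_real ((norm w)\<^sup>2)"
  by (simp add: dot4_def vcnj_def norm_vec_def L2_set_def complex_norm_square sum_nonneg del: of_real_power)

text \<open>Since \<open>alp (vcnj x) = cnj (bet x)\<close>, conjugation turns the product
  \<open>alp x * bet x\<close> into a sum of two absolute squares.\<close>

lemma bform_eigen:
  assumes "\<forall>i<6. normal_form i x = 0"
  shows "bform Lam x x = 2 * rt2 * (alp x * bet x - dot4 (wc x) (wc x))"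
    and "Re (bform Lam x (vcnj x)) =
      sqrt 2 * ((cmod (alp x))\<^sup>2 + (cmod (bet x))\<^sup>2 - 2 * (norm (wc x))\<^sup>2)"
proof -
  note eqs = assms[unfolded normal_form_iff]
  show "bform Lam x x = 2 * rt2 * (alp x * bet x - dot4 (wc x) (wc x))"
    unfolding dot4_wc by (simp add: bform_Lam sum_8 eqs alp_def bet_def algebra_simps)
  have "bform Lam x (vcnj x) = rt2 * (alp x * cnj (alp x) + bet x * cnj (bet x) - 2 * dot4 (wc x) (wc (vcnj x)))"
    unfolding dot4_wc by (simp add: bform_Lam sum_8 eqs alp_def bet_def vcnj_coords algebra_simps)
      (simp add: vcnj_def eqs algebra_simps)
  also have "\<dots> = of_real (sqrt 2 * ((cmod (alp x))\<^sup>2 + (cmod (bet x))\<^sup>2 - 2 * (norm (wc x))\<^sup>2))"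
    unfolding vcnj_coords dot4_vcnj
    by (simp add: rt2_def complex_norm_square[symmetric] del: of_real_power)
  finally show "Re (bform Lam x (vcnj x)) =
      sqrt 2 * ((cmod (alp x))\<^sup>2 + (cmod (bet x))\<^sup>2 - 2 * (norm (wc x))\<^sup>2)"
    by (simp only: Re_complex_of_real)
qed

section \<open>The four-dimensional component\<close>

lemma line_mem_image_iff:
  assumes "\<And>c x. \<lbrakk>c \<noteq> 0; x \<in> A\<rbrakk> \<Longrightarrow> c *s x \<in> A" "x \<noteq> 0"
  shows "line x \<in> line ` (A - {0}) \<longleftrightarrow> x \<in> A"
proof
  assume "line x \<in> line ` (A - {0})"
  then obtain y where y: "y \<in> A" "line x = line y" by blast
  then have "x \<in> line y" using mem_line by blast
  then obtain c where c: "x = c *s y" by (auto simp: line_eq)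
  with \<open>x \<noteq> 0\<close> have "c \<noteq> 0" by auto
  with y c show "x \<in> A" using assms(1) by blast
qed (use assms(2) in auto)

definition quad :: "complex ^ lam \<Rightarrow> complex" where
  "quad x = alp x * bet x - dot4 (wc x) (wc x)"

definition positive_vec :: "complex ^ lam \<Rightarrow> bool" where
  "positive_vec x \<longleftrightarrow> 2 * (norm (wc x))\<^sup>2 < (cmod (alp x))\<^sup>2 + (cmod (bet x))\<^sup>2"

text \<open>The last inequality selects one of the two conjugate copies, which conjugation exchanges
  together with the absolute values of \<open>alp\<close> and \<open>bet\<close>.\<close>

definition in_component :: "complex ^ lam \<Rightarrow> bool" where
  "in_component x \<longleftrightarrow> (\<forall>i<6. normal_form i x = 0) \<and> quad x = 0 \<and> positive_vec x \<and> cmod (bet x) < cmod (alp x)"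

definition component :: "(complex ^ lam) set set" where
  "component = line ` ({x. in_component x} - {0})"

lemma coords_scale:
  "alp (c *s x) = c * alp x" "bet (c *s x) = c * bet x" "normal_form i (c *s x) = c * normal_form i x"
  "wc (c *s x) = c *s wc x" "quad (c *s x) = c\<^sup>2 * quad x"
proof -
  show 1: "alp (c *s x) = c * alp x" "bet (c *s x) = c * bet x" "normal_form i (c *s x) = c * normal_form i x"
    by (simp_all add: functional_scale functional_coords)
  show 2: "wc (c *s x) = c *s wc x"
    using functional_scale[OF functional_coords(3)] by (simp add: vec_eq_iff)
  show "quad (c *s x) = c\<^sup>2 * quad x"
    by (simp add: quad_def 1 2 dot4_def sum_distrib_left algebra_simps power2_eq_square)
qed

lemma positive_vec_scale: "c \<noteq> 0 \<Longrightarrow> positive_vec (c *s x) \<longleftrightarrow> positive_vec x"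
proof -
  assume c: "c \<noteq> 0"
  have "positive_vec (c *s x) \<longleftrightarrow> (cmod c)\<^sup>2 * (2 * (norm (wc x))\<^sup>2)
      < (cmod c)\<^sup>2 * ((cmod (alp x))\<^sup>2 + (cmod (bet x))\<^sup>2)"
    by (simp add: positive_vec_def coords_scale norm_mult norm_scale_vec power_mult_distrib algebra_simps)
  then show ?thesis using c by (simp add: positive_vec_def)
qed

lemma in_component_scale: "\<lbrakk>c \<noteq> 0; in_component x\<rbrakk> \<Longrightarrow> in_component (c *s x)"
  by (simp add: in_component_def coords_scale positive_vec_scale norm_mult)

lemma line_in_component_iff: "x \<noteq> 0 \<Longrightarrow> line x \<in> component \<longleftrightarrow> in_component x"
  unfolding component_def using line_mem_image_iff[of "{x. in_component x}" x] in_component_scale by simp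

lemma in_component_nonzero: "in_component x \<Longrightarrow> alp x \<noteq> 0 \<and> x \<noteq> 0"
  using functional_zero[OF functional_coords(1)] by (auto simp: in_component_def)

lemma eigenline_in_period_domain_iff:
  assumes "x \<noteq> 0" "\<forall>i<6. normal_form i x = 0"
  shows "line x \<in> period_domain Lam \<longleftrightarrow> quad x = 0 \<and> positive_vec x"
proof -
  have "rt2 \<noteq> 0" by (simp add: rt2_def)
  then show ?thesis
    unfolding line_in_period_domain_iff[OF assms(1)] bform_eigen[OF assms(2)]
    by (simp add: quad_def positive_vec_def zero_less_mult_iff)
qed

lemma norm_dot4_le: "cmod (dot4 w w) \<le> (norm w)\<^sup>2"
proof -
  have "cmod (dot4 w w) \<le> (\<Sum>k\<in>UNIV. cmod (w $ k * w $ k))"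
    unfolding dot4_def by (rule norm_sum)
  also have "\<dots> = (norm w)\<^sup>2"
    by (simp add: norm_vec_def L2_set_def sum_nonneg norm_mult power2_eq_square)
  finally show ?thesis .
qed

text \<open>Equality would give |alp|^2 = |alp bet| = |w.w| \<le> |w|^2, while positivity would then
  say |w|^2 < |alp|^2.\<close>

lemma alp_bet_distinct:
  assumes "quad x = 0" "positive_vec x"
  shows "cmod (alp x) \<noteq> cmod (bet x)"
proof
  assume eq: "cmod (alp x) = cmod (bet x)"
  have "cmod (alp x) * cmod (bet x) = cmod (dot4 (wc x) (wc x))"
    using assms(1) by (simp add: quad_def flip: norm_mult)
  also have "\<dots> \<le> (norm (wc x))\<^sup>2" by (rule norm_dot4_le)
  finally show False using assms(2) eq by (simp add: positive_vec_def power2_eq_square)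
qed

lemma continuous_on_coords [continuous_intros]:
  "continuous_on S alp" "continuous_on S bet" "continuous_on S (normal_form i)" "continuous_on S wc"
proof -
  show "continuous_on S alp" "continuous_on S bet" "continuous_on S (normal_form i)"
    by (simp_all add: functional_continuous_on functional_coords)
  have "continuous_on S (\<lambda>x. \<chi> k. wc x $ k)"
    by (intro continuous_on_vec_lambda functional_continuous_on functional_coords)
  then show "continuous_on S wc" by simp
qed

lemma open_alp_bet:
  "open {x. cmod (bet x) < cmod (alp x)}" "open {x. cmod (alp x) < cmod (bet x)}" "open {x. positive_vec x}"
  unfolding positive_vec_def by (intro open_Collect_less continuous_intros)+

lemma homogeneous_coords:
  "homogeneous 1 alp" "homogeneous 1 (normal_form i)" "homogeneous 2 quad" "homogeneous 2 (\<lambda>x. (alp x)\<^sup>2)"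
  by (simp_all add: homogeneous_def coords_scale power_mult_distrib)

lemma quad_expand:
  "quad x = alp x * bet x - wc x $ 1 * wc x $ 1 - wc x $ 2 * wc x $ 2 - wc x $ 3 * wc x $ 3 - wc x $ 4 * wc x $ 4"
  by (simp add: quad_def dot4_def sum_4)

lemma holomorphic_several_quad: "open S \<Longrightarrow> holomorphic_several quad S"
  unfolding quad_expand[abs_def]
  by (intro holomorphic_several_diff holomorphic_several_mult holomorphic_several_functional functional_coords)

lemma quad_has_derivative:
  "(quad has_derivative (\<lambda>x. alp v * bet x + alp x * bet v - 2 * dot4 (wc v) (wc x))) (at v)"
proof -
  have der: "(L has_derivative L) (at v)" if "functional L" for L
    using bounded_linear_imp_has_derivative[OF bounded_linear_functional[OF that]] .
  have "(quad has_derivative (\<lambda>x. alp v * bet x + alp x * bet v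
      - (wc v $ 1 * wc x $ 1 + wc x $ 1 * wc v $ 1) - (wc v $ 2 * wc x $ 2 + wc x $ 2 * wc v $ 2)
      - (wc v $ 3 * wc x $ 3 + wc x $ 3 * wc v $ 3) - (wc v $ 4 * wc x $ 4 + wc x $ 4 * wc v $ 4))) (at v)"
    unfolding quad_expand[abs_def]
    by (intro has_derivative_diff has_derivative_mult der functional_coords)
  then show ?thesis
    by (rule has_derivative_eq_rhs) (simp add: dot4_def sum_4 fun_eq_iff algebra_simps)
qed

text \<open>Six linear equations and one quadric in projective 11-space leave dimension 4.\<close>

lemma component_submanifold:
  assumes "in_component v"
  shows "submanifold_at component 4 (line v)"
proof -
  \<comment> \<open>The inequalities go into the neighbourhood, so only equations remain; they also
    force \<open>alp\<close> to be nonzero, so it can serve as denominator.\<close>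
  define C where "C = {x. positive_vec x} \<inter> {x. cmod (bet x) < cmod (alp x)}"
  define N where "N = line ` (C - {0})"
  define f where "f i = (if i < (6::nat) then hquot (normal_form i) alp else hquot quad (\<lambda>x. (alp x)\<^sup>2))" for i
  define D where "D i = (if i < (6::nat) then \<lambda>x. normal_form i x / alp v
    else (\<lambda>x. (alp v * bet x + alp x * bet v - 2 * dot4 (wc v) (wc x)) / (alp v)\<^sup>2))" for i
  have v: "alp v \<noteq> 0" "v \<noteq> 0" using in_component_nonzero[OF assms] by auto
  have "open C" unfolding C_def by (intro open_Int open_alp_bet)
  then have N: "openin proj_topology N"
    unfolding N_def by (rule openin_proj_topology_line_image)
  have C_scale: "c *s x \<in> C" if "c \<noteq> 0" "x \<in> C" for c x
    using that by (simp add: C_def positive_vec_scale coords_scale norm_mult)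
  have N_iff: "line x \<in> N \<longleftrightarrow> x \<in> C" if "x \<noteq> 0" for x
    unfolding N_def using line_mem_image_iff[OF C_scale that] by blast
  have alp0: "alp x \<noteq> 0" if "x \<in> affine_cone N" for x
    using that N_iff[of x] by (auto simp: affine_cone_iff C_def)
  have coneN: "open (affine_cone N)" using N by (simp add: openin_proj_topology)
  have f_line: "f i (line x) = (if i < 6 then normal_form i x / alp x else quad x / (alp x)\<^sup>2)" if "x \<noteq> 0" for i x
    using that hquot_line[OF homogeneous_coords(2,1)] hquot_line[OF homogeneous_coords(3,4)]
    by (simp add: f_def)
  have hol: "proj_holomorphic (f i) N" for i
  proof (cases "i < 6")
    case True
    then show ?thesis
      unfolding f_def
      using proj_holomorphic_hquot[OF homogeneous_coords(2,1) N
          holomorphic_several_functional[OF functional_coords(4) coneN]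
          holomorphic_several_functional[OF functional_coords(1) coneN] alp0] by simp
  next
    case False
    have "holomorphic_several (\<lambda>x. (alp x)\<^sup>2) (affine_cone N)"
      unfolding power2_eq_square
      by (intro holomorphic_several_mult holomorphic_several_functional functional_coords coneN)
    then show ?thesis
      unfolding f_def
      using False proj_holomorphic_hquot[OF homogeneous_coords(3,4) N] holomorphic_several_quad[OF coneN] alp0
      by simp
  qed
  have zeros: "component \<inter> N = {l \<in> N. \<forall>i<7. f i l = 0}"
  proof -
    have "line x \<in> component \<longleftrightarrow> (\<forall>i<7. f i (line x) = 0)" if "x \<in> C" "x \<noteq> 0" for x
    proof -
      have "alp x \<noteq> 0" using alp0 N_iff that by (simp add: affine_cone_iff)
      then have "(\<forall>i<7. f i (line x) = 0) \<longleftrightarrow> (\<forall>i<6. normal_form i x = 0) \<and> quad x = 0"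
        using f_line[OF that(2)] by (auto simp: less_Suc_eq numeral_eq_Suc All_less_Suc)
      then show ?thesis
        using that by (simp add: line_in_component_iff in_component_def C_def)
    qed
    then show ?thesis unfolding N_def by auto
  qed
  have der: "((\<lambda>x. f i (line x)) has_derivative D i) (at v)" if "i < 7" for i
  proof (cases "i < 6")
    case True
    have "((\<lambda>x. hquot (normal_form i) alp (line x)) has_derivative (\<lambda>x. normal_form i x / alp v)) (at v)"
      using assms True
      by (intro has_derivative_hquot[OF homogeneous_coords(2,1) v(2)
          bounded_linear_imp_has_derivative[OF bounded_linear_functional[OF functional_coords(4)]]
          bounded_linear_imp_has_derivative[OF bounded_linear_functional[OF functional_coords(1)]] _ v(1)])
        (auto simp: in_component_def)
    then show ?thesis using True by (simp add: f_def D_def)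
  next
    case False
    have "((\<lambda>x. (alp x)\<^sup>2) has_derivative (\<lambda>x. alp v * alp x + alp x * alp v)) (at v)"
      unfolding power2_eq_square
      by (intro has_derivative_mult bounded_linear_imp_has_derivative[OF bounded_linear_functional] functional_coords)
    then have "((\<lambda>x. hquot quad (\<lambda>x. (alp x)\<^sup>2) (line x)) has_derivative
        (\<lambda>x. (alp v * bet x + alp x * bet v - 2 * dot4 (wc v) (wc x)) / (alp v)\<^sup>2)) (at v)"
      using assms v
      by (intro has_derivative_hquot[OF homogeneous_coords(3,4)] quad_has_derivative) (auto simp: in_component_def)
    then show ?thesis using False by (simp add: f_def D_def)
  qed
  have ind: "c i = 0" if c: "\<forall>x. (\<Sum>i<7. c i * D i x) = 0" and i: "i < 7" for c i
  proof -
    have expand: "(\<Sum>i<7. c i * D i x) = c 0 * D 0 x + c 1 * D 1 x + c 2 * D 2 x + c 3 * D 3 x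
        + c 4 * D 4 x + c 5 * D 5 x + c 6 * D 6 x" for x
      by (simp add: numeral_eq_Suc)
    have c': "c 0 * D 0 x + c 1 * D 1 x + c 2 * D 2 x + c 3 * D 3 x
        + c 4 * D 4 x + c 5 * D 5 x + c 6 * D 6 x = 0" for x
      using c expand by metis
    \<comment> \<open>\<open>vplus 0 1 0\<close> lies in the eigenspace, hence kills the linear
      differentials, while the quadric has differential \<open>1 / alp v\<close> on it.\<close>
    have "c 6 = 0"
      using c'[of "vplus 0 1 0"] v by (simp add: D_def dot4_def)
    \<comment> \<open>Each test vector has only the private coordinate of one linear equation;
      \<open>alp\<close>, \<open>bet\<close> and \<open>wc\<close>, hence the differential of the
      quadric, vanish on it.\<close>
    moreover have "c 0 = 0" "c 1 = 0" "c 2 = 0" "c 3 = 0" "c 4 = 0" "c 5 = 0"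
      using c'[of "mk_lam 1 0 0 0 0"] c'[of "mk_lam 0 0 1 0 0"]
        c'[of "mk_lam 0 0 0 0 (vec8 1 0 0 0 0 0 0 0)"] c'[of "mk_lam 0 0 0 0 (vec8 0 0 1 0 0 0 0 0)"]
        c'[of "mk_lam 0 0 0 0 (vec8 0 0 0 0 1 0 0 0)"] c'[of "mk_lam 0 0 0 0 (vec8 0 0 0 0 0 0 1 0)"] v
      by (simp_all add: D_def dot4_def normal_form_def alp_def bet_def wc_def sum_4)
    moreover have "i = 0 \<or> i = 1 \<or> i = 2 \<or> i = 3 \<or> i = 4 \<or> i = 5 \<or> i = 6" using i by linarith
    ultimately show ?thesis by blast
  qed
  have "v \<in> C" using assms by (simp add: in_component_def C_def)
  then have "line v \<in> N" using N_iff v by simp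
  moreover have "line v \<in> component" using assms v line_in_component_iff by simp
  ultimately show ?thesis
    unfolding submanifold_at_def
    by (intro conjI exI[of _ N] exI[of _ 7] exI[of _ f] exI[of _ v] exI[of _ D])
      (use N hol zeros v der ind in \<open>auto simp: CARD_lam\<close>)
qed

section \<open>Analyticity, connectedness and dimension of the component\<close>

lemma component_cases:
  assumes "l \<in> component"
  obtains x where "in_component x" "x \<noteq> 0" "l = line x"
  using assms unfolding component_def by blast

lemma regular_locus_component: "regular_locus component = component"
proof
  show "regular_locus component \<subseteq> component" by (auto simp: regular_locus_def submanifold_at_def)
  show "component \<subseteq> regular_locus component"
    using component_submanifold by (auto simp: regular_locus_def elim!: component_cases)
qed

lemma component_sub_period_domain: "component \<subseteq> period_domain Lam"
  using eigenline_in_period_domain_iff by (auto simp: in_component_def elim!: component_cases)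

text \<open>The other copy must not accumulate at this one: at every period in the eigenspace one of
  the two strict inequalities between \<open>alp\<close> and \<open>bet\<close> holds, and it
  persists nearby. Within the period domain the quadric and positivity are automatic.\<close>

lemma analytic_subset_component: "analytic_subset (period_domain Lam) component"
  unfolding analytic_subset_def
proof (intro conjI component_sub_period_domain ballI)
  fix p assume p: "p \<in> period_domain Lam"
  then have "p \<in> proj_space" by (simp add: period_domain_def)
  then obtain v where v: "v \<noteq> 0" "p = line v" by (rule proj_space_cases)
  let ?goal = "\<exists>N k f. openin proj_topology N \<and> p \<in> N \<and> (\<forall>i<k::nat. proj_holomorphic (f i) N) \<and>
     component \<inter> N = {l \<in> period_domain Lam \<inter> N. \<forall>i<k. f i l = 0}"
  \<comment> \<open>Away from the component the equation 1 = 0 describes it.\<close>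
  have empty: ?goal if A: "open A" "v \<in> A" "\<And>x. x \<in> A \<Longrightarrow> \<not> in_component x" for A
  proof -
    let ?N = "line ` (A - {0})"
    have N: "openin proj_topology ?N" using A(1) by (rule openin_proj_topology_line_image)
    have "component \<inter> ?N = {}"
      using A(3) line_in_component_iff by auto
    then show ?thesis
      using N proj_holomorphic_const[OF N, of 1] v A(2)
      by (intro exI[of _ ?N] exI[of _ 1] exI[of _ "\<lambda>i l. 1"]) auto
  qed
  show ?goal
  proof (cases "\<exists>i<6. normal_form i v \<noteq> 0")
    case True
    then obtain i where i: "i < 6" "normal_form i v \<noteq> 0" by blast
    have "open {x. normal_form i x \<noteq> 0}" by (intro open_Collect_neq continuous_intros)
    then show ?thesis using i by (intro empty[of "{x. normal_form i x \<noteq> 0}"]) (auto simp: in_component_def)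
  next
    case False
    then have "quad v = 0" "positive_vec v" using p v eigenline_in_period_domain_iff by auto
    then consider "cmod (alp v) < cmod (bet v)" | "cmod (bet v) < cmod (alp v)"
      using alp_bet_distinct by fastforce
    then show ?thesis
    proof cases
      case 1
      then show ?thesis
        by (intro empty[of "{x. cmod (alp x) < cmod (bet x)}"] open_alp_bet) (auto simp: in_component_def)
    next
      case 2
      define A where "A = {x. cmod (bet x) < cmod (alp x)}"
      define N where "N = line ` (A - {0})"
      have N: "openin proj_topology N"
        unfolding N_def A_def by (intro openin_proj_topology_line_image open_alp_bet)
      have A_scale: "c *s x \<in> A" if "c \<noteq> 0" "x \<in> A" for c x
        using that by (simp add: A_def coords_scale norm_mult)
      have N_iff: "line x \<in> N \<longleftrightarrow> x \<in> A" if "x \<noteq> 0" for x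
        unfolding N_def using line_mem_image_iff[OF A_scale that] by blast
      have "proj_holomorphic (hquot (normal_form i) alp) N" for i
        using N N_iff
        by (intro proj_holomorphic_hquot[OF homogeneous_coords(2,1)] holomorphic_several_functional functional_coords)
          (auto simp: openin_proj_topology affine_cone_iff A_def)
      moreover have "line x \<in> component \<longleftrightarrow> line x \<in> period_domain Lam \<and> (\<forall>i<6. hquot (normal_form i) alp (line x) = 0)"
        if "x \<in> A" "x \<noteq> 0" for x
      proof -
        have "alp x \<noteq> 0" using that by (auto simp: A_def)
        then have "(\<forall>i<6. hquot (normal_form i) alp (line x) = 0) \<longleftrightarrow> (\<forall>i<6. normal_form i x = 0)"
          using hquot_line[OF homogeneous_coords(2,1) that(2)] by simp
        then show ?thesis
          using that line_in_component_iff eigenline_in_period_domain_iff by (auto simp: in_component_def A_def)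
      qed
      then have "component \<inter> N = {l \<in> period_domain Lam \<inter> N. \<forall>i<6. hquot (normal_form i) alp l = 0}"
        unfolding N_def by auto
      moreover have "p \<in> N" using 2 v N_iff by (simp add: A_def)
      ultimately show ?thesis
        using N by (intro exI[of _ N] exI[of _ 6] exI[of _ "\<lambda>i. hquot (normal_form i) alp"]) simp
    qed
  qed
qed

text \<open>With a = |w.w|, b = |w|^2 and u = t^2, shrinking \<open>w\<close> by t increases 1 + a^2
  - 2 b by (1 - u)(2 b - a^2 (1 + u)), which is nonnegative because a^2 \<le> a \<le> b.\<close>

lemma starlike_lie_ball:
  "starlike {w :: complex ^ 4. cmod (dot4 w w) < 1 \<and> 2 * (norm w)\<^sup>2 < 1 + (cmod (dot4 w w))\<^sup>2}"
  (is "starlike ?D")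
  unfolding starlike_def
proof (intro bexI ballI subsetI)
  show "0 \<in> ?D" by (simp add: dot4_def)
  fix w y assume w: "w \<in> ?D" and "y \<in> closed_segment 0 w"
  then obtain t where t: "0 \<le> t" "t \<le> 1" "y = t *\<^sub>R w" by (auto simp: in_segment)
  define a where "a = cmod (dot4 w w)"
  define b where "b = (norm w)\<^sup>2"
  define u where "u = t\<^sup>2"
  have "dot4 y y = of_real u * dot4 w w"
    unfolding t(3) u_def dot4_def scaleR_vec_conv_scale
    by (simp add: sum_distrib_left power2_eq_square algebra_simps)
  then have dy: "cmod (dot4 y y) = u * a" by (simp add: a_def u_def norm_mult norm_power)
  have ny: "(norm y)\<^sup>2 = u * b" by (simp add: t(3) u_def b_def power_mult_distrib)
  have u: "0 \<le> u" "u \<le> 1" using t by (simp_all add: u_def power_le_one)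
  have a: "0 \<le> a" "a < 1" "a \<le> b" "2 * b < 1 + a\<^sup>2"
    using w norm_dot4_le[of w] by (simp_all add: a_def b_def)
  have "a\<^sup>2 \<le> a" using a by (simp add: power2_eq_square mult_left_le)
  then have "a\<^sup>2 * (1 + u) \<le> b * 2" using a u by (intro mult_mono) auto
  then have "0 \<le> (1 - u) * (2 * b - a\<^sup>2 * (1 + u))" using u by (intro mult_nonneg_nonneg) auto
  also have "\<dots> = (1 + (u * a)\<^sup>2 - 2 * (u * b)) - (1 + a\<^sup>2 - 2 * b)"
    by (simp add: power2_eq_square algebra_simps)
  finally have "2 * (u * b) < 1 + (u * a)\<^sup>2" using a(4) by linarith
  moreover have "u * a < 1" using a u by (meson mult_left_le_one_le order.strict_trans1)
  ultimately show "y \<in> ?D" by (simp add: dy ny)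
qed

text \<open>Both sides have the same coordinates. The expansion yields continuity and reduces a
  functional on the eigenspace to six values.\<close>

lemma vplus_linear:
  "vplus a b w = a *s vplus 1 0 0 + b *s vplus 0 1 0 + (\<Sum>k\<in>UNIV. w $ k *s vplus 0 0 (axis k 1))"
  (is "_ = ?y")
proof -
  note lin = functional_coords[THEN functional_add] functional_coords[THEN functional_scale]
    functional_coords[THEN functional_sum]
  have "normal_form i ?y = 0" for i by (simp add: lin)
  moreover have "alp ?y = a" "bet ?y = b" by (simp_all add: lin)
  moreover have "wc ?y = w"
  proof -
    have "wc ?y $ j = (\<Sum>k\<in>UNIV. w $ k * axis k 1 $ j)" for j
      by (simp add: functional_coords(3)[THEN functional_add] functional_coords(3)[THEN functional_scale]
          functional_coords(3)[THEN functional_sum])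
    also have "\<dots> j = w $ j" for j
      by (simp add: axis_def if_distrib cong: if_cong)
    finally show ?thesis by (simp add: vec_eq_iff)
  qed
  ultimately show ?thesis using vplus_coords[of ?y] by simp
qed

text \<open>Normalizing \<open>\<alpha> = 1\<close> identifies the component with the Lie ball, via \<open>\<beta> = \<Sum> w\<^sub>k\<^sup>2\<close>.\<close>

lemma component_eq_image:
  "component = (\<lambda>w. line (vplus 1 (dot4 w w) w)) `
     {w. cmod (dot4 w w) < 1 \<and> 2 * (norm w)\<^sup>2 < 1 + (cmod (dot4 w w))\<^sup>2}" (is "_ = ?f ` ?D")
proof (intro equalityI subsetI)
  fix l assume "l \<in> ?f ` ?D"
  then obtain w where w: "w \<in> ?D" "l = ?f w" by blast
  then have "in_component (vplus 1 (dot4 w w) w)"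
    by (simp add: in_component_def quad_def positive_vec_def)
  then show "l \<in> component" using w(2) in_component_nonzero line_in_component_iff by blast
next
  fix l assume "l \<in> component"
  then obtain x where x: "in_component x" "x \<noteq> 0" "l = line x" by (rule component_cases)
  then have "alp x \<noteq> 0" using in_component_nonzero by blast
  define y where "y = (1 / alp x) *s x"
  have y: "in_component y" unfolding y_def using x(1) \<open>alp x \<noteq> 0\<close> by (intro in_component_scale) auto
  have a: "alp y = 1" using \<open>alp x \<noteq> 0\<close> by (simp add: y_def coords_scale)
  have b: "bet y = dot4 (wc y) (wc y)" using y a by (simp add: in_component_def quad_def)
  have "y = vplus 1 (dot4 (wc y) (wc y)) (wc y)"
    using vplus_coords[of y] y a b by (simp add: in_component_def)
  moreover have "line y = l" unfolding y_def x(3) using \<open>alp x \<noteq> 0\<close> by (intro line_scale) simp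
  ultimately have "l = ?f (wc y)" by metis
  moreover have "wc y \<in> ?D" using y a b by (simp add: in_component_def positive_vec_def)
  ultimately show "l \<in> ?f ` ?D" by (rule image_eqI)
qed

lemma component_nonempty: "component \<noteq> {}"
proof -
  have "0 \<in> {w :: complex ^ 4. cmod (dot4 w w) < 1 \<and> 2 * (norm w)\<^sup>2 < 1 + (cmod (dot4 w w))\<^sup>2}"
    by (simp add: dot4_def)
  then show ?thesis unfolding component_eq_image by blast
qed

lemma connectedin_component: "connectedin proj_topology component"
  unfolding component_eq_image
proof (rule connectedin_continuous_map_image)
  let ?g = "\<lambda>w. vplus 1 (dot4 w w) w"
  have nz: "?g w \<noteq> 0" for w
    using functional_zero[OF functional_coords(1)] coords_vplus(1) by (metis zero_neq_one)
  have cont: "continuous_on UNIV ?g"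
  proof -
    have eq: "?g = (\<lambda>w. 1 *s vplus 1 0 0 + dot4 w w *s vplus 0 1 0 + (\<Sum>k\<in>UNIV. w $ k *s vplus 0 0 (axis k 1)))"
      by (intro ext) (rule vplus_linear)
    show ?thesis
      by (subst eq, unfold dot4_def)
        (intro continuous_intros bounded_linear.continuous_on[OF bounded_linear_scale_vec])
  qed
  show "continuous_map euclidean proj_topology (\<lambda>w. line (?g w))"
    unfolding continuous_map_def
  proof (intro conjI allI impI)
    show "(\<lambda>w. line (?g w)) \<in> topspace euclidean \<rightarrow> topspace proj_topology"
      using nz line_in_proj_space by (auto simp: topspace_proj_topology)
    fix N assume "openin proj_topology (N :: (complex ^ lam) set set)"
    then have "open (?g -` affine_cone N)"
      using cont by (intro open_vimage) (auto simp: openin_proj_topology)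
    also have "?g -` affine_cone N = {w \<in> topspace euclidean. line (?g w) \<in> N}"
      using nz by (auto simp: affine_cone_iff)
    finally show "openin euclidean {w \<in> topspace euclidean. line (?g w) \<in> N}" by simp
  qed
  show "connectedin euclidean {w :: complex ^ 4. cmod (dot4 w w) < 1 \<and> 2 * (norm w)\<^sup>2 < 1 + (cmod (dot4 w w))\<^sup>2}"
    using starlike_imp_connected[OF starlike_lie_ball] by simp
qed

lemma irreducible_component: "irreducible_analytic (period_domain Lam) component"
  unfolding irreducible_analytic_def regular_locus_component
proof (intro conjI analytic_subset_component component_nonempty connectedin_component closure_of_subset)
  show "component \<subseteq> topspace proj_topology"
    using component_sub_period_domain by (auto simp: topspace_proj_topology period_domain_def)
qed

text \<open>Uniqueness of the local dimension turns the set under \<open>Sup\<close> into a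
  singleton.\<close>

lemma complex_dim_component: "complex_dim component = 4"
proof -
  have "{d. \<exists>p. submanifold_at component d p} = {4}"
  proof (intro equalityI subsetI)
    fix d assume "d \<in> {d. \<exists>p. submanifold_at component d p}"
    then obtain p where p: "submanifold_at component d p" by blast
    then have "p \<in> component" by (simp add: submanifold_at_def)
    then have "submanifold_at component 4 p" using component_submanifold by (auto elim!: component_cases)
    then show "d \<in> {4}" using submanifold_at_dim_unique[OF p] by simp
  next
    fix d :: nat assume "d \<in> {4}"
    then show "d \<in> {d. \<exists>p. submanifold_at component d p}"
      using component_nonempty component_submanifold by (auto elim!: component_cases)
  qed
  then show ?thesis by (simp add: complex_dim_def)
qed

section \<open>The component lies in the locus\<close>

lemma complexify_map_lam_sim: "complexify_map lam_sim x = lam_sim x"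
proof (rule complex_linear_eqI[where f = "complexify_map lam_sim" and g = lam_sim])
  fix v :: "rat ^ lam"
  have c: "lam_coords (rat_vec v) $ k = of_rat (lam_coords v $ k)" for v :: "rat ^ lam" and k
  proof -
    have "\<forall>k. lam_coords (rat_vec v) $ k = of_rat (lam_coords v $ k)"
      by (simp add: forall_8 lam_coords_def e8_coords_def rat_vec_def of_rat_add of_rat_diff of_rat_divide)
    then show ?thesis by blast
  qed
  have "rat_vec (lam_sim v) = lam_sim (rat_vec v)"
  proof (rule lam_eqI)
    show "lam_coords (rat_vec (lam_sim v)) = lam_coords (lam_sim (rat_vec v))"
      by (simp add: vec_eq_iff forall_8 c) (simp add: lam_sim_def pair_sim_def c of_rat_add of_rat_diff)
  qed (simp_all add: rat_vec_def lam_sim_def of_rat_mult)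
  then show "complexify_map lam_sim (rat_vec v) = lam_sim (rat_vec v)"
    by (simp add: complexify_map_rat_vec linear_lam_sim)
qed (simp_all add: complexify_map_add complexify_map_scale lam_sim_add lam_sim_scale)

lemma component_sub_locus: "component \<subseteq> similarity_locus Lam 2"
proof
  fix l assume l: "l \<in> component"
  then obtain x where x: "in_component x" "x \<noteq> 0" "l = line x" by (rule component_cases)
  have "lam_sim x = rt2 *s x" using x(1) eigen_iff_normal_form by (simp add: in_component_def)
  then have eig: "complexify_map lam_sim x = rt2 *s x" by (simp add: complexify_map_lam_sim)
  show "l \<in> similarity_locus Lam 2"
    unfolding x(3)
  proof (rule line_in_similarity_locusI[OF Lam_sym x(2) _ linear_lam_sim lam_sim_lam_sim _ _ eig])
    show "line x \<in> period_domain Lam" using l x(3) component_sub_period_domain by blast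
    show "rosati_fixed Lam lam_sim" by (simp add: rosati_fixed_def lam_sim_self_adjoint)
  qed simp
qed

section \<open>Maximality\<close>

text \<open>On the Lie ball the functional becomes the polynomial A + (w.w) B + \<Sum> w_k C_k. The
  origin gives A = 0, and opposite points on an axis separate the even coefficient B from the odd
  C_k.\<close>

lemma functional_vanishing_on_component:
  assumes L: "functional L" and van: "\<And>x. in_component x \<Longrightarrow> L x = 0"
    and x: "\<forall>i<6. normal_form i x = 0"
  shows "L x = 0"
proof -
  define A where "A = L (vplus 1 0 0)"
  define B where "B = L (vplus 0 1 0)"
  define C where "C k = L (vplus 0 0 (axis k 1))" for k
  have L_vplus: "L (vplus a b w) = a * A + b * B + (\<Sum>k\<in>UNIV. w $ k * C k)" for a b w
    by (subst vplus_linear)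
      (simp add: functional_add[OF L] functional_scale[OF L] functional_sum[OF L] A_def B_def C_def)
  have zero: "A + dot4 w w * B + (\<Sum>k\<in>UNIV. w $ k * C k) = 0"
    if "cmod (dot4 w w) < 1" "2 * (norm w)\<^sup>2 < 1 + (cmod (dot4 w w))\<^sup>2" for w
  proof -
    have "in_component (vplus 1 (dot4 w w) w)" using that by (simp add: in_component_def quad_def positive_vec_def)
    then show ?thesis using van L_vplus[of 1 "dot4 w w" w] by simp
  qed
  have A: "A = 0" using zero[of 0] by (simp add: dot4_def)
  \<comment> \<open>The points 1/4 and -1/4 on an axis lie inside the Lie ball: 1/16 < 1 and 2/16 <
    1 + 1/256.\<close>
  have axis: "t\<^sup>2 * B + t * C k = 0" if "t = 1/4 \<or> t = -1/4" for t k
  proof -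
    let ?w = "t *s axis k 1 :: complex ^ 4"
    have dot: "dot4 ?w ?w = t\<^sup>2"
      by (simp add: dot4_def axis_def if_distrib power2_eq_square cong: if_cong)
    have t: "cmod t = 1/4" using that by (elim disjE; hypsubst) (simp_all add: norm_divide)
    have norms: "(norm ?w)\<^sup>2 = 1/16" "cmod (t\<^sup>2) = 1/16"
      unfolding norm_scale_vec norm_axis_1 norm_power t by (simp_all add: power2_eq_square)
    have "?w $ j * C j = (if j = k then t * C k else 0)" for j by (simp add: axis_def)
    then have sum: "(\<Sum>j\<in>UNIV. ?w $ j * C j) = t * C k" by simp
    have "A + dot4 ?w ?w * B + (\<Sum>j\<in>UNIV. ?w $ j * C j) = 0"
      by (rule zero; unfold dot norms) (simp_all add: power2_eq_square)
    then show ?thesis unfolding dot sum A by simp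
  qed
  have C: "C k = 0" and B: "B = 0" for k
    using axis[of "1/4" k] axis[of "-1/4" k] by (simp_all add: power2_eq_square)
  show ?thesis
    using L_vplus[of "alp x" "bet x" "wc x"] vplus_coords[OF x] by (simp add: A B C)
qed

lemma rt2_irrational:
  assumes "of_rat p + rt2 * of_rat q = 0"
  shows "q = 0"
proof (rule ccontr)
  assume "q \<noteq> 0"
  then have "rt2 = of_rat (- p / q)"
    using assms by (simp add: of_rat_divide of_rat_minus field_simps add_eq_0_iff)
  then have "rt2 * rt2 = of_rat ((- p / q) * (- p / q))" by (simp only: of_rat_mult)
  then have "of_rat ((p / q)\<^sup>2) = (of_rat 2 :: complex)" by (simp add: power2_eq_square)
  then have sq: "(p / q)\<^sup>2 = 2" by (simp only: of_rat_eq_iff)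
  obtain a b where ab: "quotient_of (p / q) = (a, b)" by fastforce
  then have "p / q = of_int a / of_int b" "b > 0" "coprime a b"
    using quotient_of_div quotient_of_denom_pos quotient_of_coprime by blast+
  then have "of_int a = p / q * of_int b" by simp
  then have "of_int (a\<^sup>2) = (p / q)\<^sup>2 * of_int (b\<^sup>2)" by (simp add: power_mult_distrib power_divide)
  then have "of_int (a\<^sup>2) = (of_int (2 * b\<^sup>2) :: rat)" unfolding sq by simp
  then have eq: "a\<^sup>2 = 2 * b\<^sup>2" by (simp only: of_int_eq_iff)
  then have "even a" by (metis dvd_triv_left even_power)
  then obtain c where c: "a = 2 * c" by blast
  then have "b\<^sup>2 = 2 * c\<^sup>2" using eq by (simp add: power2_eq_square)
  then have "even b" by (metis dvd_triv_left even_power)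
  with \<open>even a\<close> \<open>coprime a b\<close> show False by (meson coprime_common_divisor odd_one)
qed

lemma rational_map_with_eigenspace:
  fixes A :: "rat ^ lam ^ lam"
  defines "A' \<equiv> \<chi> i j. complex_of_rat (A $ i $ j)"
  assumes \<mu>: "\<mu>\<^sup>2 = 2"
    and eig: "\<And>x. \<forall>i<6. normal_form i x = 0 \<Longrightarrow> A' *v x = \<mu> *s x"
    and x: "A' *v x = \<mu> *s x"
  shows "\<forall>i<6. normal_form i x = 0"
proof -
  have "\<mu>\<^sup>2 = rt2\<^sup>2" using \<mu> by (simp add: power2_eq_square)
  \<comment> \<open>The sign is taken as a rational number so that it can be a coefficient over the
    rationals.\<close>
  then obtain e :: rat where e: "\<mu> = of_rat e * rt2" "e = 1 \<or> e = -1"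
    unfolding power2_eq_iff using that[of 1] that[of "-1"] by (auto simp: of_rat_minus)
  have A'_rat: "A' *v rat_vec r = rat_vec (A *v r)" for r
    by (simp add: A'_def rat_vec_def matrix_vector_mult_def vec_eq_iff of_rat_sum of_rat_mult)
  have sim_rat: "lam_sim (rat_vec r) = rat_vec (lam_sim r)" for r
    by (metis complexify_map_lam_sim complexify_map_rat_vec linear_lam_sim)
  have "A *v r = e *s lam_sim r" for r
  proof -
    \<comment> \<open>As the square of \<open>lam_sim\<close> is 2, applying \<open>lam_sim\<close>
      + sqrt 2 to any vector lands in the sqrt 2-eigenspace.\<close>
    define y where "y = lam_sim (rat_vec r) + rt2 *s rat_vec r"
    have "lam_sim y = rt2 *s y"
      by (simp add: y_def lam_sim_add lam_sim_scale lam_sim_lam_sim vec.scale_right_distrib)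
    then have "A' *v y = \<mu> *s y" using eig eigen_iff_normal_form by blast
    then have *: "rat_vec (A *v lam_sim r) + rt2 *s rat_vec (A *v r) =
        \<mu> *s rat_vec (lam_sim r) + (\<mu> * rt2) *s rat_vec r"
      by (simp add: y_def matrix_vector_right_distrib vector_scalar_commute sim_rat A'_rat vec.scale_right_distrib)
    have "(A *v r) $ i = e * lam_sim r $ i" for i
    proof -
      \<comment> \<open>The coefficient of sqrt 2 in the eigenvector equation is the identity wanted
        for \<open>A\<close>.\<close>
      have "of_rat ((A *v lam_sim r) $ i - 2 * e * r $ i) + rt2 * of_rat ((A *v r) $ i - e * lam_sim r $ i) = 0"
        using arg_cong[OF *, of "\<lambda>v. v $ i"]
        by (simp add: rat_vec_def e(1) of_rat_diff of_rat_mult algebra_simps)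
      from rt2_irrational[OF this] show ?thesis by simp
    qed
    then show ?thesis by (simp add: vec_eq_iff)
  qed
  then have A'_rat_vec: "A' *v rat_vec r = of_rat e *s lam_sim (rat_vec r)" for r
    by (simp add: A'_rat sim_rat) (simp add: rat_vec_def vec_eq_iff of_rat_mult)
  have "A' *v z = of_rat e *s lam_sim z" for z
    by (rule complex_linear_eqI[where f = "\<lambda>z. A' *v z" and g = "\<lambda>z. of_rat e *s lam_sim z"])
      (simp_all add: A'_rat_vec matrix_vector_right_distrib vector_scalar_commute
        lam_sim_add lam_sim_scale vec.scale_right_distrib mult.commute)
  then show ?thesis
    using x e unfolding eigen_iff_normal_form[symmetric] by auto
qed

lemma component_maximal:
  assumes irr: "irreducible_analytic (period_domain Lam) W"
    and sub: "component \<subseteq> W" "W \<subseteq> similarity_locus Lam 2"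
  shows "W = component"
proof -
  define cmat where "cmat A = (\<chi> i j. complex_of_rat (A $ i $ j))" for A :: "rat ^ lam ^ lam"
  \<comment> \<open>A section is encoded by the coordinate functionals of \<open>A\<close> -
    \<open>\<mu>\<close>.\<close>
  define sec where "sec = (\<lambda>(A, \<mu>). range (\<lambda>i x. (cmat A *v x - \<mu> *s x) $ i))"
  define \<L> where "\<L> = sec ` (UNIV \<times> {rt2, - rt2})"
  have sec_iff: "(\<forall>L\<in>sec (A, \<mu>). L x = 0) \<longleftrightarrow> cmat A *v x = \<mu> *s x" for A \<mu> x
    by (auto simp: sec_def vec_eq_iff)
  have fun_sec: "functional L" if "L \<in> sec (A, \<mu>)" for L A \<mu>
    using that by (auto simp: sec_def functional_iff matrix_vector_right_distrib vector_scalar_commute algebra_simps)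
  have WX: "W \<subseteq> period_domain Lam" using irr by (simp add: irreducible_analytic_def analytic_subset_def)
  have cover: "\<exists>\<Phi>\<in>\<L>. \<forall>L\<in>\<Phi>. L x = 0" if x: "x \<noteq> 0" "line x \<in> W" for x
  proof -
    obtain A \<mu> where A: "cmat A *v x = \<mu> *s x" "\<mu>\<^sup>2 = of_rat 2"
      using similarity_locus_eigenline[of x Lam 2] x sub(2) unfolding cmat_def by blast
    then have "\<mu>\<^sup>2 = rt2\<^sup>2" by (simp add: power2_eq_square)
    then have "\<mu> \<in> {rt2, - rt2}" by (simp add: power2_eq_iff)
    then show ?thesis using A(1) sec_iff unfolding \<L>_def by blast
  qed
  have "countable \<L>" unfolding \<L>_def by (intro countable_image countable_SIGMA) auto
  obtain \<Phi> where \<Phi>: "\<Phi> \<in> \<L>" "\<And>x L. \<lbrakk>x \<noteq> 0; line x \<in> W; L \<in> \<Phi>\<rbrakk> \<Longrightarrow> L x = 0"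
  proof (rule irreducible_in_one_section[OF irr \<open>countable \<L>\<close>])
    show "functional L" if "\<Phi> \<in> \<L>" "L \<in> \<Phi>" for \<Phi> L
      using that fun_sec unfolding \<L>_def by blast
    show "\<exists>\<Phi>\<in>\<L>. \<forall>L\<in>\<Phi>. L x = 0" if "x \<noteq> 0" "line x \<in> W" for x
      using cover that .
  qed (rule that)
  then obtain A \<mu> where A: "\<Phi> = sec (A, \<mu>)" "\<mu> = rt2 \<or> \<mu> = - rt2" unfolding \<L>_def by blast
  have \<mu>: "\<mu>\<^sup>2 = 2" using A(2) by (auto simp: power2_eq_square)
  have W_eig: "cmat A *v x = \<mu> *s x" if "x \<noteq> 0" "line x \<in> W" for x
    using \<Phi>(2)[OF that] A(1) sec_iff by blast
  have V_eig: "cmat A *v x = \<mu> *s x" if "\<forall>i<6. normal_form i x = 0" for x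
  proof -
    have "L x = 0" if L: "L \<in> sec (A, \<mu>)" for L
    proof (rule functional_vanishing_on_component[OF fun_sec[OF L] _ \<open>\<forall>i<6. normal_form i x = 0\<close>])
      fix z assume "in_component z"
      then have "z \<noteq> 0" "line z \<in> W" using in_component_nonzero line_in_component_iff sub(1) by blast+
      then show "L z = 0" using \<Phi>(2) L A(1) by blast
    qed
    then show ?thesis using sec_iff by blast
  qed
  have W_nf: "\<forall>i<6. normal_form i x = 0" if "x \<noteq> 0" "line x \<in> W" for x
    using rational_map_with_eigenspace[OF \<mu>, of A x] V_eig W_eig[OF that] unfolding cmat_def by blast
  \<comment> \<open>In the eigenspace \<open>W\<close> is covered by two disjoint open sets. Its
    connected regular locus meets \<open>P\<close>, hence avoids \<open>Q\<close>, and by density so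
    does \<open>W\<close>.\<close>
  define P where "P = line ` ({x. cmod (bet x) < cmod (alp x)} - {0})"
  define Q where "Q = line ` ({x. cmod (alp x) < cmod (bet x)} - {0})"
  have P: "line x \<in> P \<longleftrightarrow> cmod (bet x) < cmod (alp x)" if "x \<noteq> 0" for x
    unfolding P_def using line_mem_image_iff[of "{x. cmod (bet x) < cmod (alp x)}" x] that
    by (simp add: coords_scale norm_mult)
  have Q: "line x \<in> Q \<longleftrightarrow> cmod (alp x) < cmod (bet x)" if "x \<noteq> 0" for x
    unfolding Q_def using line_mem_image_iff[of "{x. cmod (alp x) < cmod (bet x)}" x] that
    by (simp add: coords_scale norm_mult)
  have op: "openin proj_topology P" "openin proj_topology Q"
    unfolding P_def Q_def by (intro openin_proj_topology_line_image open_alp_bet)+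
  have PQ: "P \<inter> Q = {}"
    using Q unfolding P_def by (auto dest: less_asym)
  have W_cases: "(l \<in> P \<and> l \<in> component) \<or> l \<in> Q" if l: "l \<in> W" for l
  proof -
    have "l \<in> proj_space" using WX l by (auto simp: period_domain_def)
    then obtain x where x: "x \<noteq> 0" "l = line x" by (rule proj_space_cases)
    have nf: "\<forall>i<6. normal_form i x = 0" using W_nf x l by blast
    then have "quad x = 0" "positive_vec x" using eigenline_in_period_domain_iff x l WX by blast+
    then show ?thesis
      using alp_bet_distinct[of x] nf x P Q line_in_component_iff by (auto simp: in_component_def)
  qed
  let ?R = "regular_locus W"
  have conn: "connectedin proj_topology ?R" and dense: "W \<subseteq> proj_topology closure_of ?R"
    using irr by (auto simp: irreducible_analytic_def)
  have RW: "?R \<subseteq> W" by (auto simp: regular_locus_def submanifold_at_def)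
  have meets: "N \<inter> ?R \<noteq> {}" if "openin proj_topology N" "N \<inter> W \<noteq> {}" for N
    using that dense by (auto simp: in_closure_of subset_iff)
  have "P \<inter> W \<noteq> {}"
  proof -
    obtain l where "l \<in> component" using component_nonempty by blast
    moreover from this have "l \<in> P" using P by (auto simp: in_component_def elim!: component_cases)
    ultimately show ?thesis using sub(1) by blast
  qed
  then have "P \<inter> ?R \<noteq> {}" using meets op by blast
  moreover have "?R \<subseteq> P \<union> Q" using RW W_cases by blast
  ultimately have "Q \<inter> ?R = {}"
    using conn PQ op unfolding connectedin by blast
  then have "Q \<inter> W = {}" using meets op by blast
  then have "W \<subseteq> component" using W_cases by blast
  then show ?thesis using sub(1) by blast
qed

theorem proposition2p6:
  "similarity_locus Lam 2 \<noteq> {} \<and>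
   (\<exists>Z. locus_component (period_domain Lam) (similarity_locus Lam 2) Z \<and> complex_dim Z = 4)"
proof
  show "similarity_locus Lam 2 \<noteq> {}"
    using component_nonempty component_sub_locus by blast
  have "locus_component (period_domain Lam) (similarity_locus Lam 2) component"
    unfolding locus_component_def
    using irreducible_component component_sub_locus component_maximal by blast
  then show "\<exists>Z. locus_component (period_domain Lam) (similarity_locus Lam 2) Z \<and> complex_dim Z = 4"
    using complex_dim_component by blast
qed

end
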